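(* Let $A,A^*$ be a Leonard pair in $\mathcal A$, let $\Phi=(A;\{E_i\}_{i=0}^d;A^*;\{E^*_i\}_{i=0}^d)$ be a Leonard system associated with $A,A^*$, and let $(\{\theta_i\}_{i=0}^d;\{\theta^*_i\}_{i=0}^d;\{\varphi_i\}_{i=1}^d;\{\phi_i\}_{i=1}^d)$ be the parameter array of $\Phi$. Assume $d\ge1$. Let $\xi,\zeta,\xi^*,\zeta^*\in\mathbb K$ with $\xi,\xi^*$ nonzero. Then the Leonard pair $A,A^*$ is isomorphic to the Leonard pair $\xi A+\zeta I,\ \xi^*A^*+\zeta^*I$ if and only if at least one of (i)--(iv) holds: (i) $\xi=1$, $\zeta=0$, $\xi^*=1$, $\zeta^*=0$. (ii) $\varphi_1=-\phi_d$, $\varphi_d=-\phi_1$, $\xi=1$, $\zeta=0$, $\xi^*=-1$, $\zeta^*=\theta^*_0+\theta^*_d$. (iii) $\varphi_1=-\phi_1$, $\varphi_d=-\phi_d$, $\xi=-1$, $\zeta=\theta_0+\theta_d$, $\xi^*=1$, $\zeta^*=0$. (iv) $\varphi_1=\varphi_d$, $\phi_1=\phi_d$, $\xi=-1$, $\zeta=\theta_0+\theta_d$, $\xi^*=-1$, $\zeta^*=\theta^*_0+\theta^*_d$. In this case precisely one of (i)--(iv) holds.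
   Context: Let $\mathbb K$ be a field, $d\ge 0$ an integer, $\mathcal A$ a $\mathbb K$-algebra isomorphic to $\mathrm{Mat}_{d+1}(\mathbb K)$ with identity $I$, and $V$ an irreducible left $\mathcal A$-module (so $\dim V=d+1$). A square matrix is irreducible tridiagonal if its nonzero entries all lie on the diagonal, subdiagonal or superdiagonal, and every subdiagonal and superdiagonal entry is nonzero. Leonard pair: an ordered pair $A,A^*$ of elements of $\mathcal A$ is a Leonard pair in $\mathcal A$ if (i) there is a basis of $V$ with respect to which the matrix representing $A$ is irreducible tridiagonal and the matrix representing $A^*$ is diagonal, and (ii) there is a basis of $V$ with respect to which the matrix representing $A^*$ is irreducible tridiagonal and the matrix representing $A$ is diagonal. ($A^*$ is just a name; it does not denote the conjugate transpose.) If $A,A^*$ is a Leonard pair in $\mathcal A$, then so is $\xi A+\zeta I,\ \xi^*A^*+\zeta^*I$ for all $\xi,\zeta,\xi^*,\zeta^*\in\mathbb K$ with $\xi,\xi^*$ nonzero. Leonard pairs $A,A^*$ in $\mathcal A$ and $B,B^*$ in $\mathcal A'$ are isomorphic if there is a $\mathbb K$-algebra isomorphism $\mathcal A\to\mathcal A'$ sending $A\mapsto B$ and $A^*\mapsto B^*$. Leonard system: an element $A\in\mathcal A$ is multiplicity-free if it has $d+1$ mutually distinct eigenvalues $\theta_0,\dots,\theta_d$ in $\mathbb K$; its primitive idempotent associated with $\theta_i$ is $E_i=\prod_{j\neq i}(A-\theta_jI)/(\theta_i-\theta_j)$. A Leonard system in $\mathcal A$ is a sequence $\Phi=(A;\{E_i\}_{i=0}^d;A^*;\{E^*_i\}_{i=0}^d)$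 such that $A,A^*\in\mathcal A$ are multiplicity-free, $\{E_i\}_{i=0}^d$ (resp. $\{E_i^*\}_{i=0}^d$) is an ordering of the primitive idempotents of $A$ (resp. $A^*$), and for $0\le i,j\le d$ each of $E_iA^*E_j$ and $E^*_iAE^*_j$ is zero if $|i-j|>1$ and nonzero if $|i-j|=1$. If $\Phi$ is a Leonard system then $A,A^*$ is a Leonard pair, and $\Phi$ is said to be associated with $A,A^*$; every Leonard pair has an associated Leonard system. Parameter array: let $\theta_i$ (resp. $\theta_i^*$) be the eigenvalue of $A$ (resp. $A^*$) associated with $E_i$ (resp. $E^*_i$). For $1\le i\le d$ put $$\varphi_i=(\theta^*_0-\theta^*_i)\frac{\mathrm{tr}\bigl(E^*_0\prod_{h=0}^{i-1}(A-\theta_hI)\bigr)}{\mathrm{tr}\bigl(E^*_0\prod_{h=0}^{i-2}(A-\theta_hI)\bigr)},\qquad \phi_i=(\theta^*_0-\theta^*_i)\frac{\mathrm{tr}\bigl(E^*_0\prod_{h=0}^{i-1}(A-\theta_{d-h}I)\bigr)}{\mathrm{tr}\bigl(E^*_0\prod_{h=0}^{i-2}(A-\theta_{d-h}I)\bigr)},$$ where the empty product is $I$ and the denominators are known to be nonzero. The parameter array of $\Phi$ is $(\{\theta_i\}_{i=0}^d;\{\theta^*_i\}_{i=0}^d;\{\varphi_i\}_{i=1}^d;\{\phi_i\}_{i=1}^d)$. *)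

theory Defs
  imports "Jordan_Normal_Form.Matrix"
begin

(* Associative unital algebras over a field 'k: the underlying ring is the type 'a, and
   scale is the scalar multiplication. *)
locale k_algebra = vector_space scale
  for scale :: "'k::field \<Rightarrow> 'a::ring_1 \<Rightarrow> 'a" +
  assumes scale_mult_left: "scale c x * y = scale c (x * y)"
    and scale_mult_right: "x * scale c y = scale c (x * y)"

locale matrix_algebra = k_algebra scale
  for scale :: "'k::field \<Rightarrow> 'a::ring_1 \<Rightarrow> 'a" +
  fixes d :: nat
  assumes iso_Mat:
    "\<exists>f. bij_betw f (UNIV :: 'a set) (carrier_mat (d + 1) (d + 1) :: 'k mat set) \<and>
         (\<forall>x y. f (x + y) = f x + f y) \<and> (\<forall>x y. f (x * y) = f x * f y) \<and>
         f 1 = 1\<^sub>m (d + 1) \<and> (\<forall>c x. f (scale c x) = c \<cdot>\<^sub>m f x)"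

definition algebra_iso ::
  "('k::field \<Rightarrow> 'a::ring_1 \<Rightarrow> 'a) \<Rightarrow> ('k \<Rightarrow> 'b::ring_1 \<Rightarrow> 'b) \<Rightarrow> ('a \<Rightarrow> 'b) \<Rightarrow> bool" where
  "algebra_iso scaleA scaleB f \<longleftrightarrow>
     bij f \<and> (\<forall>x y. f (x + y) = f x + f y) \<and> (\<forall>x y. f (x * y) = f x * f y) \<and>
     f 1 = 1 \<and> (\<forall>c x. f (scaleA c x) = scaleB c (f x))"

(* The action determines scaleV, since scaleV c v = act (scaleA c 1) v. *)
locale algebra_module = k_algebra scaleA + V: vector_space scaleV
  for scaleA :: "'k::field \<Rightarrow> 'a::ring_1 \<Rightarrow> 'a"
    and scaleV :: "'k \<Rightarrow> 'v::ab_group_add \<Rightarrow> 'v" +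
  fixes act :: "'a \<Rightarrow> 'v \<Rightarrow> 'v"
  assumes act_add_left: "act (x + y) v = act x v + act y v"
    and act_add_right: "act x (v + w) = act x v + act x w"
    and act_mult: "act (x * y) v = act x (act y v)"
    and act_one: "act 1 v = v"
    and act_scale: "act (scaleA c x) v = scaleV c (act x v)"

locale irreducible_module = algebra_module scaleA scaleV act
  for scaleA :: "'k::field \<Rightarrow> 'a::ring_1 \<Rightarrow> 'a"
    and scaleV :: "'k \<Rightarrow> 'v::ab_group_add \<Rightarrow> 'v"
    and act :: "'a \<Rightarrow> 'v \<Rightarrow> 'v" +
  assumes nonzero: "\<exists>v::'v. v \<noteq> 0"
    and irreducible: "V.subspace W \<Longrightarrow> (\<And>x w. w \<in> W \<Longrightarrow> act x w \<in> W) \<Longrightarrow> W = {0} \<or> W = UNIV"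

(* v 0, ..., v d is an ordered basis of V; the values v i with i > d are irrelevant. *)
definition ordered_basis ::
  "('k::field \<Rightarrow> 'v::ab_group_add \<Rightarrow> 'v) \<Rightarrow> nat \<Rightarrow> (nat \<Rightarrow> 'v) \<Rightarrow> bool" where
  "ordered_basis scaleV d v \<longleftrightarrow>
     inj_on v {..d} \<and> \<not> module.dependent scaleV (v ` {..d}) \<and>
     module.span scaleV (v ` {..d}) = UNIV"

definition represents ::
  "('k::field \<Rightarrow> 'v::ab_group_add \<Rightarrow> 'v) \<Rightarrow> ('a \<Rightarrow> 'v \<Rightarrow> 'v) \<Rightarrow> nat \<Rightarrow>
     (nat \<Rightarrow> 'v) \<Rightarrow> 'k mat \<Rightarrow> 'a \<Rightarrow> bool" where
  "represents scaleV act d v Y X \<longleftrightarrow>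
     Y \<in> carrier_mat (d + 1) (d + 1) \<and>
     (\<forall>j\<le>d. act X (v j) = (\<Sum>i\<le>d. scaleV (Y $$ (i, j)) (v i)))"

definition irreducible_tridiagonal :: "'k::field mat \<Rightarrow> bool" where
  "irreducible_tridiagonal Y \<longleftrightarrow>
     square_mat Y \<and>
     (\<forall>i<dim_row Y. \<forall>j<dim_col Y.
        (\<bar>int i - int j\<bar> > 1 \<longrightarrow> Y $$ (i, j) = 0) \<and>
        (\<bar>int i - int j\<bar> = 1 \<longrightarrow> Y $$ (i, j) \<noteq> 0))"

definition leonard_pair ::
  "('k::field \<Rightarrow> 'v::ab_group_add \<Rightarrow> 'v) \<Rightarrow> ('a \<Rightarrow> 'v \<Rightarrow> 'v) \<Rightarrow> nat \<Rightarrow> 'a \<Rightarrow> 'a \<Rightarrow> bool" where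
  "leonard_pair scaleV act d A As \<longleftrightarrow>
     (\<exists>v Y Ys. ordered_basis scaleV d v \<and>
        represents scaleV act d v Y A \<and> represents scaleV act d v Ys As \<and>
        irreducible_tridiagonal Y \<and> diagonal_mat Ys) \<and>
     (\<exists>v Y Ys. ordered_basis scaleV d v \<and>
        represents scaleV act d v Y A \<and> represents scaleV act d v Ys As \<and>
        diagonal_mat Y \<and> irreducible_tridiagonal Ys)"

definition leonard_pair_iso ::
  "('k::field \<Rightarrow> 'a::ring_1 \<Rightarrow> 'a) \<Rightarrow> ('k \<Rightarrow> 'b::ring_1 \<Rightarrow> 'b) \<Rightarrow> 'a \<Rightarrow> 'a \<Rightarrow> 'b \<Rightarrow> 'b \<Rightarrow> bool" where
  "leonard_pair_iso scaleA scaleB A As B Bs \<longleftrightarrow>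
     (\<exists>f. algebra_iso scaleA scaleB f \<and> f A = B \<and> f As = Bs)"

definition eigenvalues ::
  "('k::field \<Rightarrow> 'v::ab_group_add \<Rightarrow> 'v) \<Rightarrow> ('a \<Rightarrow> 'v \<Rightarrow> 'v) \<Rightarrow> 'a \<Rightarrow> 'k set" where
  "eigenvalues scaleV act A = {t. \<exists>v. v \<noteq> 0 \<and> act A v = scaleV t v}"

definition multiplicity_free ::
  "('k::field \<Rightarrow> 'v::ab_group_add \<Rightarrow> 'v) \<Rightarrow> ('a \<Rightarrow> 'v \<Rightarrow> 'v) \<Rightarrow> nat \<Rightarrow> 'a \<Rightarrow> bool" where
  "multiplicity_free scaleV act d A \<longleftrightarrow> card (eigenvalues scaleV act A) = d + 1"

(* The factors commute, but 'a is not a commutative type, hence prod_list. *)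
definition primitive_idempotent ::
  "('k::field \<Rightarrow> 'a::ring_1 \<Rightarrow> 'a) \<Rightarrow> nat \<Rightarrow> 'a \<Rightarrow> (nat \<Rightarrow> 'k) \<Rightarrow> nat \<Rightarrow> 'a" where
  "primitive_idempotent scaleA d A \<theta> i =
     (\<Prod>j\<leftarrow>filter (\<lambda>j. j \<noteq> i) [0..<d + 1]. scaleA (inverse (\<theta> i - \<theta> j)) (A - scaleA (\<theta> j) 1))"

(* \<theta> 0, ..., \<theta> d lists the eigenvalues of A, and E i is the primitive idempotent of A associated
   with \<theta> i. *)
definition eigen_ordering ::
  "('k::field \<Rightarrow> 'a::ring_1 \<Rightarrow> 'a) \<Rightarrow> ('k \<Rightarrow> 'v::ab_group_add \<Rightarrow> 'v) \<Rightarrow> ('a \<Rightarrow> 'v \<Rightarrow> 'v) \<Rightarrow> nat \<Rightarrow>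
     'a \<Rightarrow> (nat \<Rightarrow> 'k) \<Rightarrow> (nat \<Rightarrow> 'a) \<Rightarrow> bool" where
  "eigen_ordering scaleA scaleV act d A \<theta> E \<longleftrightarrow>
     bij_betw \<theta> {..d} (eigenvalues scaleV act A) \<and>
     (\<forall>i\<le>d. E i = primitive_idempotent scaleA d A \<theta> i)"

definition leonard_system ::
  "('k::field \<Rightarrow> 'a::ring_1 \<Rightarrow> 'a) \<Rightarrow> ('k \<Rightarrow> 'v::ab_group_add \<Rightarrow> 'v) \<Rightarrow> ('a \<Rightarrow> 'v \<Rightarrow> 'v) \<Rightarrow> nat \<Rightarrow>
     'a \<Rightarrow> (nat \<Rightarrow> 'a) \<Rightarrow> 'a \<Rightarrow> (nat \<Rightarrow> 'a) \<Rightarrow> bool" where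
  "leonard_system scaleA scaleV act d A E As Es \<longleftrightarrow>
     multiplicity_free scaleV act d A \<and> multiplicity_free scaleV act d As \<and>
     (\<exists>\<theta>. eigen_ordering scaleA scaleV act d A \<theta> E) \<and>
     (\<exists>\<theta>s. eigen_ordering scaleA scaleV act d As \<theta>s Es) \<and>
     (\<forall>i\<le>d. \<forall>j\<le>d.
        (\<bar>int i - int j\<bar> > 1 \<longrightarrow> E i * As * E j = 0 \<and> Es i * A * Es j = 0) \<and>
        (\<bar>int i - int j\<bar> = 1 \<longrightarrow> E i * As * E j \<noteq> 0 \<and> Es i * A * Es j \<noteq> 0))"

(* The trace of the matrix representing X with respect to any basis of V. *)
definition algebra_trace ::
  "('k::field \<Rightarrow> 'v::ab_group_add \<Rightarrow> 'v) \<Rightarrow> ('a \<Rightarrow> 'v \<Rightarrow> 'v) \<Rightarrow> nat \<Rightarrow> 'a \<Rightarrow> 'k" where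
  "algebra_trace scaleV act d X =
     (THE t. \<exists>v Y. ordered_basis scaleV d v \<and> represents scaleV act d v Y X \<and>
        t = (\<Sum>i\<le>d. Y $$ (i, i)))"

(* (A - \<theta> 0 I) (A - \<theta> 1 I) ... (A - \<theta> (n - 1) I), which is I for n = 0 *)
definition shifted_prod ::
  "('k::field \<Rightarrow> 'a::ring_1 \<Rightarrow> 'a) \<Rightarrow> 'a \<Rightarrow> (nat \<Rightarrow> 'k) \<Rightarrow> nat \<Rightarrow> 'a" where
  "shifted_prod scaleA A \<theta> n = (\<Prod>h\<leftarrow>[0..<n]. A - scaleA (\<theta> h) 1)"

(* (\<theta>; \<theta>s; \<phi>1; \<phi>2) is the parameter array of (A; E; As; Es): \<phi>1 is the first split sequence
   (varphi in the literature), \<phi>2 the second (phi).  The sequences \<theta>, \<theta>s are indexed by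
   0, ..., d and \<phi>1, \<phi>2 by 1, ..., d; other values are unconstrained. *)
definition parameter_array ::
  "('k::field \<Rightarrow> 'a::ring_1 \<Rightarrow> 'a) \<Rightarrow> ('k \<Rightarrow> 'v::ab_group_add \<Rightarrow> 'v) \<Rightarrow> ('a \<Rightarrow> 'v \<Rightarrow> 'v) \<Rightarrow> nat \<Rightarrow>
     'a \<Rightarrow> (nat \<Rightarrow> 'a) \<Rightarrow> 'a \<Rightarrow> (nat \<Rightarrow> 'a) \<Rightarrow>
     (nat \<Rightarrow> 'k) \<Rightarrow> (nat \<Rightarrow> 'k) \<Rightarrow> (nat \<Rightarrow> 'k) \<Rightarrow> (nat \<Rightarrow> 'k) \<Rightarrow> bool" where
  "parameter_array scaleA scaleV act d A E As Es \<theta> \<theta>s \<phi>1 \<phi>2 \<longleftrightarrow>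
     (let tr = algebra_trace scaleV act d in
     eigen_ordering scaleA scaleV act d A \<theta> E \<and>
     eigen_ordering scaleA scaleV act d As \<theta>s Es \<and>
     (\<forall>i\<in>{1..d}. \<phi>1 i = (\<theta>s 0 - \<theta>s i) *
        (tr (Es 0 * shifted_prod scaleA A \<theta> i) / tr (Es 0 * shifted_prod scaleA A \<theta> (i - 1)))) \<and>
     (\<forall>i\<in>{1..d}. \<phi>2 i = (\<theta>s 0 - \<theta>s i) *
        (tr (Es 0 * shifted_prod scaleA A (\<lambda>h. \<theta> (d - h)) i) /
         tr (Es 0 * shifted_prod scaleA A (\<lambda>h. \<theta> (d - h)) (i - 1)))))"

end

theory Submission
  imports Defs "HOL-Computational_Algebra.Polynomial"
begin

text \<open>
Write \<open>A\<close>, \<open>As\<close> for the pair, \<open>E i\<close>, \<open>Es i\<close> for the idempotents and \<open>\<theta> i\<close>, \<open>\<theta>s i\<close> for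
the eigenvalues.  Define scalars \<open>x\<close>, \<open>y\<close> by \<open>E 0 * As * E 0 = x E 0\<close> and
\<open>E d * As * E d = y E d\<close>.  The whole argument is governed by the fact that the four end terms of the
split sequences are
\<open>\<phi>1 1 = (\<theta> 0 - \<theta> 1) (x - \<theta>s 0)\<close>, \<open>\<phi>2 d = (\<theta> 0 - \<theta> 1) (x - \<theta>s d)\<close>,
\<open>\<phi>2 1 = (\<theta> d - \<theta> (d - 1)) (y - \<theta>s 0)\<close>, \<open>\<phi>1 d = (\<theta> d - \<theta> (d - 1)) (y - \<theta>s d)\<close>,
and that the same numbers have dual expressions in which \<open>A\<close> and \<open>As\<close> are exchanged
(lemmas \<open>split_start\<close>, \<open>split_end\<close>, \<open>corner_relation\<close>, each applied to the given system and
to the systems obtained by reversing \<open>E\<close>, \<open>Es\<close> or both).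

Necessity.  An affine change of generators does not change the primitive idempotents, so an isomorphism
onto the affine image permutes the \<open>E i\<close>.  It respects the relation \<open>E i * As * E j \<noteq> 0\<close>, hence the
permutation is an automorphism of the path \<open>0, ..., d\<close>: the identity or the reversal.  Comparing
eigenvalues gives \<open>(\<xi>, \<zeta>) = (1, 0)\<close> or \<open>(-1, \<theta> 0 + \<theta> d)\<close>, and dually for \<open>As\<close>.  Comparing
the corner scalars \<open>x\<close>, \<open>y\<close> with their images gives the conditions on the split sequences
(\<open>iso_first_cases\<close>).

Sufficiency.  The conditions on the split sequences, read through the formulas above, yield
\<open>\<theta> 1 + \<theta> (d - 1) = \<theta> 0 + \<theta> d\<close> and/or its dual.  The eigenvalues satisfy
\<open>a (\<theta> (i + 2) + \<theta> (i + 1) + \<theta> i) + c = \<theta> (i + 1)\<close> for constants \<open>a\<close>, \<open>c\<close>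
(\<open>three_term_recurrence\<close>), and for such sequences of distinct elements symmetry at the ends propagates
inwards (\<open>symmetric_of_recurrence\<close>): \<open>\<theta> i + \<theta> (d - i) = \<theta> 0 + \<theta> d\<close> for all \<open>i\<close>.
Therefore the affine image, with its idempotents reversed, has the same eigenvalue sequences as the
given system; the condition on \<open>\<phi>1 1\<close> says that it also has the same corner scalar \<open>x\<close>.
These data determine the system up to isomorphism: if \<open>v\<close> spans the image of \<open>Es 0\<close>, then in the
basis \<open>E i v\<close> the element \<open>As\<close> is a tridiagonal matrix that acts triangularly on the vectors
\<open>p(A) v\<close>, and its rows can be solved for from the action on \<open>1\<close>, \<open>A\<close> and \<open>A\<^sup>2\<close>
(\<open>leonard_matrix_unique\<close>).
\<close>

section \<open>Sequences with a symmetric three-term recurrence\<close>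

text \<open>
The defect \<open>g i = t i + t (d - i) - t 0 - t d\<close> satisfies the recurrence with some constant term
\<open>\<kappa>\<close> and vanishes at \<open>0, 1, d - 1, d\<close>.  If \<open>\<kappa> = 0\<close>, two consecutive zeros kill it.  If
\<open>\<kappa> \<noteq> 0\<close>, then \<open>g\<close> and its differences span all solutions starting at \<open>0\<close>, so \<open>t - t 0\<close> is a
combination of them and vanishes at \<open>d - 1\<close> together with \<open>g\<close>, contrary to \<open>t (d - 1) \<noteq> t 0\<close>.
The argument is uniform in \<open>\<beta>\<close> and in the characteristic.
\<close>
lemma symmetric_of_recurrence:
  fixes t :: "nat \<Rightarrow> 'k::field"
  assumes d: "2 \<le> d"
    and rec: "\<And>i. i + 2 \<le> d \<Longrightarrow> t (i + 2) + t i = \<beta> * t (i + 1) + \<gamma>"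
    and ends: "t 1 + t (d - 1) = t 0 + t d"
    and ne: "t (d - 1) \<noteq> t 0"
    and i: "i \<le> d"
  shows "t i + t (d - i) = t 0 + t d"
proof -
  define g where "g i = t i + t (d - i) - t 0 - t d" for i
  define \<kappa> where "\<kappa> = 2 * \<gamma> + (\<beta> - 2) * (t 0 + t d)"
  define \<gamma>' where "\<gamma>' = \<gamma> + (\<beta> - 2) * t 0"
  have g0: "g 0 = 0" and g1: "g 1 = 0" and gd1: "g (d - 1) = 0" and gd: "g d = 0"
    using ends d by (auto simp: g_def algebra_simps)
  have grec: "g (i + 2) = \<beta> * g (i + 1) - g i + \<kappa>" if "i + 2 \<le> d" for i
  proof -
    have "t (i + 2) + t i = \<beta> * t (i + 1) + \<gamma>" using rec that by blast
    moreover have "t (d - i) + t (d - (i + 2)) = \<beta> * t (d - (i + 1)) + \<gamma>"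
      using rec[of "d - (i + 2)"] that by (simp add: Suc_diff_le numeral_2_eq_2 Suc_diff_Suc)
    ultimately have e1: "t (i + 2) = \<beta> * t (i + 1) + \<gamma> - t i"
      and e2: "t (d - (i + 2)) = \<beta> * t (d - (i + 1)) + \<gamma> - t (d - i)"
      by (simp_all add: algebra_simps)
    show ?thesis
      unfolding g_def \<kappa>_def e1 e2 by (simp add: algebra_simps)
  qed
  have key: "\<kappa> * (t i - t 0) = (t 1 - t 0) * (g (i + 1) - g i) + \<gamma>' * g i \<and>
      (i + 2 \<le> d \<longrightarrow>
        \<kappa> * (t (i + 1) - t 0) = (t 1 - t 0) * (g (i + 2) - g (i + 1)) + \<gamma>' * g (i + 1))"
    if "i + 1 \<le> d" for i
    using that
  proof (induction i)
    case 0
    have "g (Suc (Suc 0)) = \<kappa>" if "2 \<le> d" using grec[of 0] g0 g1 that by (simp add: numeral_2_eq_2)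
    thus ?case using g0 g1 d by (simp add: algebra_simps numeral_2_eq_2)
  next
    case (Suc i)
    have c1: "\<kappa> * (t i - t 0) = (t 1 - t 0) * (g (i + 1) - g i) + \<gamma>' * g i"
      and c2: "\<kappa> * (t (i + 1) - t 0) = (t 1 - t 0) * (g (i + 2) - g (i + 1)) + \<gamma>' * g (i + 1)"
      using Suc by auto
    have "\<kappa> * (t (i + 2) - t 0) = (t 1 - t 0) * (g (i + 3) - g (i + 2)) + \<gamma>' * g (i + 2)"
      if "i + 3 \<le> d"
    proof -
      have r: "t (i + 2) = \<beta> * t (i + 1) + \<gamma> - t i" using rec[of i] that by (simp add: algebra_simps)
      have g2: "g (i + 2) = \<beta> * g (i + 1) - g i + \<kappa>" using grec[of i] that by simp
      have g3: "g (i + 3) = \<beta> * g (i + 2) - g (i + 1) + \<kappa>"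
        using grec[of "i + 1"] that by (simp add: numeral_eq_Suc)
      have "\<kappa> * (t (i + 2) - t 0) =
          \<beta> * (\<kappa> * (t (i + 1) - t 0)) - \<kappa> * (t i - t 0) + \<kappa> * \<gamma>'"
        unfolding r \<gamma>'_def by (simp add: algebra_simps)
      also have "\<dots> = (t 1 - t 0) * (g (i + 3) - g (i + 2)) + \<gamma>' * g (i + 2)"
        unfolding c1 c2 g3 g2 by (simp add: algebra_simps)
      finally show ?thesis .
    qed
    thus ?case using c2 by (simp add: numeral_eq_Suc)
  qed
  have "\<kappa> * (t (d - 1) - t 0) = 0"
    using key[of "d - 1"] d gd gd1 by simp
  hence k0: "\<kappa> = 0" using ne by simp
  have "g i = 0 \<and> (i + 1 \<le> d \<longrightarrow> g (i + 1) = 0)" if "i \<le> d" for i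
    using that
  proof (induction i)
    case 0
    thus ?case using g0 g1 by simp
  next
    case (Suc i)
    thus ?case using grec[of i] k0 by (simp add: numeral_2_eq_2)
  qed
  thus ?thesis using i by (simp add: g_def algebra_simps)
qed

section \<open>Polynomials on finitely many nodes\<close>

text \<open>Newton's form of interpolation: node \<open>Suc d\<close> is corrected by a multiple of the polynomial that
vanishes at the earlier nodes.\<close>
lemma interpolation:
  fixes \<theta> :: "nat \<Rightarrow> 'k::field"
  assumes "inj_on \<theta> {..d}"
  shows "\<exists>p. degree p \<le> d \<and> (\<forall>i\<le>d. poly p (\<theta> i) = g i)"
  using assms
proof (induction d)
  case 0
  show ?case by (rule exI[of _ "[:g 0:]"]) simp
next
  case (Suc d)
  have "inj_on \<theta> {..d}" using Suc.prems by (rule inj_on_subset) auto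
  then obtain p where p: "degree p \<le> d" "\<forall>i\<le>d. poly p (\<theta> i) = g i" using Suc.IH by blast
  define r where "r = (\<Prod>i\<le>d. [:- \<theta> i, 1:])"
  have r0: "poly r (\<theta> i) = 0" if "i \<le> d" for i
    using that by (auto simp: r_def poly_prod)
  have r1: "poly r (\<theta> (Suc d)) \<noteq> 0"
    using Suc.prems by (auto simp: r_def poly_prod inj_on_eq_iff)
  have dr: "degree r \<le> Suc d"
    unfolding r_def by (rule order.trans[OF degree_prod_sum_le]) auto
  define c where "c = (g (Suc d) - poly p (\<theta> (Suc d))) / poly r (\<theta> (Suc d))"
  have "degree (p + smult c r) \<le> Suc d"
    using p(1) dr by (intro degree_add_le) (auto intro: order.trans[OF degree_smult_le])
  moreover have "poly (p + smult c r) (\<theta> i) = g i" if "i \<le> Suc d" for i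
    using that p(2) r0 r1 by (cases "i = Suc d") (auto simp: c_def le_Suc_eq)
  ultimately show ?case by blast
qed

lemma poly_eq_0_on_nodes:
  fixes \<theta> :: "nat \<Rightarrow> 'k::field"
  assumes inj: "inj_on \<theta> {..d}" and deg: "degree p \<le> d" and z: "\<And>i. i \<le> d \<Longrightarrow> poly p (\<theta> i) = 0"
  shows "p = 0"
  by (rule poly_eqI_degree[of "\<theta> ` {..d}"]) (use inj deg z in \<open>auto simp: card_image\<close>)

section \<open>Tridiagonal matrices acting triangularly on polynomials\<close>

text \<open>
The matrix \<open>b\<close> of \<open>As\<close> in an eigenbasis of \<open>A\<close>, normalised so that \<open>p(A) v\<close> has the coordinates
\<open>p (\<theta> 0), ..., p (\<theta> d)\<close>.  Triangularity expresses that on polynomials of degree at most \<open>k\<close>,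
modulo lower degree, \<open>As\<close> is multiplication by \<open>\<theta>s k\<close>.  The condition on the coefficients of
\<open>q\<close> reads \<open>degree q < k\<close>, with \<open>q = 0\<close> when \<open>k = 0\<close>.
\<close>
locale leonard_matrix =
  fixes d :: nat and \<theta> \<theta>s :: "nat \<Rightarrow> 'k::field" and b :: "nat \<Rightarrow> nat \<Rightarrow> 'k"
  assumes d_pos: "1 \<le> d"
    and inj: "inj_on \<theta> {..d}" and injs: "inj_on \<theta>s {..d}"
    and tridiagonal: "i \<le> d \<Longrightarrow> j \<le> d \<Longrightarrow> i + 1 < j \<or> j + 1 < i \<Longrightarrow> b i j = 0"
    and triangular: "degree p \<le> k \<Longrightarrow> k \<le> d \<Longrightarrow>
      \<exists>q. (\<forall>n\<ge>k. coeff q n = 0) \<and>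
        (\<forall>i\<le>d. (\<Sum>j\<le>d. b i j * poly p (\<theta> j)) = \<theta>s k * poly p (\<theta> i) + poly q (\<theta> i))"
begin

lemma \<theta>_eq_iff: "i \<le> d \<Longrightarrow> j \<le> d \<Longrightarrow> \<theta> i = \<theta> j \<longleftrightarrow> i = j"
  using inj by (auto simp: inj_on_def)

lemma row_first: "(\<Sum>j\<le>d. b 0 j * g j) = b 0 0 * g 0 + b 0 1 * g 1"
proof -
  have "(\<Sum>j\<le>d. b 0 j * g j) = (\<Sum>j\<in>{0, 1}. b 0 j * g j)"
    using d_pos tridiagonal by (intro sum.mono_neutral_right) auto
  thus ?thesis by simp
qed

lemma row_last: "(\<Sum>j\<le>d. b d j * g j) = b d (d - 1) * g (d - 1) + b d d * g d"
proof -
  have "(\<Sum>j\<le>d. b d j * g j) = (\<Sum>j\<in>{d - 1, d}. b d j * g j)"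
    using d_pos tridiagonal by (intro sum.mono_neutral_right) auto
  thus ?thesis using d_pos by auto
qed

lemma row_middle:
  assumes "0 < i" "i < d"
  shows "(\<Sum>j\<le>d. b i j * g j) = b i (i - 1) * g (i - 1) + b i i * g i + b i (i + 1) * g (i + 1)"
proof -
  have "(\<Sum>j\<le>d. b i j * g j) = (\<Sum>j\<in>{i - 1, i, i + 1}. b i j * g j)"
  proof (intro sum.mono_neutral_right ballI)
    fix j assume "j \<in> {..d} - {i - 1, i, i + 1}"
    hence "j \<le> d" "i + 1 < j \<or> j + 1 < i" by auto
    thus "b i j * g j = 0" using tridiagonal[of i j] assms by simp
  qed (use assms in auto)
  moreover have "i - 1 \<noteq> i" "i - 1 \<noteq> i + 1" using assms by auto
  ultimately show ?thesis by simp
qed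

lemma row_sum: "i \<le> d \<Longrightarrow> (\<Sum>j\<le>d. b i j) = \<theta>s 0"
proof -
  assume i: "i \<le> d"
  obtain q where "\<forall>n\<ge>0. coeff q n = 0"
    "\<forall>i\<le>d. (\<Sum>j\<le>d. b i j * poly 1 (\<theta> j)) = \<theta>s 0 * poly 1 (\<theta> i) + poly q (\<theta> i)"
    using triangular[of 1 0] by auto
  moreover from this have "q = 0" by (auto intro: poly_eqI)
  ultimately show ?thesis using i by simp
qed

lemma row_sum_1: "\<exists>c. \<forall>i\<le>d. (\<Sum>j\<le>d. b i j * \<theta> j) = \<theta>s 1 * \<theta> i + c"
proof -
  obtain q where q: "\<forall>n\<ge>1. coeff q n = 0"
    "\<forall>i\<le>d. (\<Sum>j\<le>d. b i j * poly [:0, 1:] (\<theta> j)) = \<theta>s 1 * poly [:0, 1:] (\<theta> i) + poly q (\<theta> i)"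
    using triangular[of "[:0, 1:]" 1] d_pos by auto
  have "q = [:coeff q 0:]" using q(1) by (auto intro!: poly_eqI simp: coeff_pCons split: nat.split)
  hence "poly q x = poly [:coeff q 0:] x" for x by (rule arg_cong)
  hence "poly q x = coeff q 0" for x by simp
  thus ?thesis using q(2) by auto
qed

lemma row_sum_2:
  assumes "2 \<le> d"
  shows "\<exists>r s. \<forall>i\<le>d. (\<Sum>j\<le>d. b i j * (\<theta> j)\<^sup>2) = \<theta>s 2 * (\<theta> i)\<^sup>2 + r * \<theta> i + s"
proof -
  obtain q where q: "\<forall>n\<ge>2. coeff q n = 0"
    "\<forall>i\<le>d. (\<Sum>j\<le>d. b i j * poly [:0, 0, 1:] (\<theta> j)) =
      \<theta>s 2 * poly [:0, 0, 1:] (\<theta> i) + poly q (\<theta> i)"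
    using triangular[of "[:0, 0, 1:]" 2] assms by auto
  have e: "q = [:coeff q 0, coeff q 1:]"
    using q(1) by (auto intro!: poly_eqI simp: coeff_pCons numeral_2_eq_2 split: nat.split)
  have "poly q x = coeff q 1 * x + coeff q 0" for x
    by (subst e) (simp add: algebra_simps)
  thus ?thesis using q(2) by (auto simp: power2_eq_square add_ac)
qed

text \<open>
Choose \<open>z\<close> with \<open>z i - z j = \<theta> i \<theta> j (\<theta> i - \<theta> j)\<close> for adjacent \<open>i\<close>, \<open>j\<close>.  As only
adjacent indices contribute, \<open>\<theta>s 0 z - b z\<close> has entries
\<open>(\<theta> i)\<^sup>2 (b \<theta>) i - \<theta> i (b \<theta>\<^sup>2) i\<close>, and by triangularity these are the values of a
polynomial of degree at most \<open>3\<close>.  Since \<open>\<theta>s 0 \<noteq> \<theta>s k\<close> for \<open>k > 0\<close>, the map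
\<open>\<theta>s 0 - b\<close> preserves every positive degree, so \<open>z\<close> itself is a cubic in \<open>\<theta>\<close>.  Dividing the
difference equation for \<open>z\<close> twice by differences of eigenvalues leaves the recurrence.
\<close>
lemma three_term_recurrence:
  "\<exists>a c. \<forall>i. i + 2 \<le> d \<longrightarrow> a * (\<theta> (i + 2) + \<theta> (i + 1) + \<theta> i) + c = \<theta> (i + 1)"
proof (cases "2 \<le> d")
  case False
  thus ?thesis by auto
next
  case True
  define z where "z n = (\<Sum>i<n. \<theta> (Suc i) * \<theta> i * (\<theta> (Suc i) - \<theta> i))" for n
  have z_adj: "z i - z j = \<theta> i * \<theta> j * (\<theta> i - \<theta> j)" if "\<not> (i + 1 < j \<or> j + 1 < i)" for i j
  proof -
    have "i = j \<or> i = Suc j \<or> j = Suc i" using that by linarith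
    thus ?thesis by (auto simp: z_def algebra_simps)
  qed
  obtain c where c: "\<forall>i\<le>d. (\<Sum>j\<le>d. b i j * \<theta> j) = \<theta>s 1 * \<theta> i + c" using row_sum_1 by blast
  obtain r s where rs: "\<forall>i\<le>d. (\<Sum>j\<le>d. b i j * (\<theta> j)\<^sup>2) = \<theta>s 2 * (\<theta> i)\<^sup>2 + r * \<theta> i + s"
    using row_sum_2[OF True] by blast
  define R where "R = [:0, - s, c - r, \<theta>s 1 - \<theta>s 2:]"
  have R: "\<theta>s 0 * z i - (\<Sum>j\<le>d. b i j * z j) = poly R (\<theta> i)" if i: "i \<le> d" for i
  proof -
    have "\<theta>s 0 * z i - (\<Sum>j\<le>d. b i j * z j) = (\<Sum>j\<le>d. b i j * (z i - z j))"
      using row_sum[OF i] by (simp add: right_diff_distrib sum_subtractf flip: sum_distrib_right)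
    also have "\<dots> = (\<Sum>j\<le>d. b i j * (\<theta> i * \<theta> j * (\<theta> i - \<theta> j)))"
      using tridiagonal[OF i] z_adj by (intro sum.cong refl) (metis atMost_iff mult_zero_left)
    also have "\<dots> = (\<theta> i)\<^sup>2 * (\<Sum>j\<le>d. b i j * \<theta> j) - \<theta> i * (\<Sum>j\<le>d. b i j * (\<theta> j)\<^sup>2)"
      by (simp add: sum_distrib_left power2_eq_square algebra_simps flip: sum_subtractf)
    also have "\<dots> = poly R (\<theta> i)"
      using c rs i by (simp add: R_def algebra_simps power2_eq_square)
    finally show ?thesis .
  qed
  obtain p where p: "degree p \<le> d" "\<forall>i\<le>d. poly p (\<theta> i) = z i" using interpolation[OF inj] by blast
  have dp: "degree p \<le> 3"
  proof (rule ccontr)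
    assume *: "\<not> degree p \<le> 3"
    define k where "k = degree p"
    obtain q where q: "\<forall>n\<ge>k. coeff q n = 0"
      "\<forall>i\<le>d. (\<Sum>j\<le>d. b i j * poly p (\<theta> j)) = \<theta>s k * poly p (\<theta> i) + poly q (\<theta> i)"
      using triangular[of p k] p(1) by (auto simp: k_def)
    define P where "P = smult (\<theta>s 0 - \<theta>s k) p - q - R"
    have degR: "degree R \<le> 3" unfolding R_def by simp
    have "P = 0"
    proof (rule poly_eq_0_on_nodes[OF inj])
      have "degree q \<le> d" using q(1) p(1) by (intro degree_le) (auto simp: k_def)
      moreover have "degree R \<le> d" using degR * p(1) by linarith
      ultimately show "degree P \<le> d"
        unfolding P_def using p(1) by (intro degree_diff_le) (auto intro: order.trans[OF degree_smult_le])
      show "poly P (\<theta> i) = 0" if "i \<le> d" for i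
        using R[OF that] q(2) p(2) that by (simp add: P_def algebra_simps)
    qed
    moreover have "coeff P k = (\<theta>s 0 - \<theta>s k) * lead_coeff p"
      using q(1) degR * by (simp add: P_def k_def coeff_eq_0)
    moreover have "\<theta>s 0 \<noteq> \<theta>s k" using inj_on_eq_iff[OF injs, of 0 k] p(1) * by (auto simp: k_def)
    ultimately show False using * by auto
  qed
  define a3 where "a3 = coeff p 3"
  define a2 where "a2 = coeff p 2"
  define a1 where "a1 = coeff p 1"
  define a0 where "a0 = coeff p 0"
  have "p = [:a0, a1, a2, a3:]"
    using dp by (auto intro!: poly_eqI simp: a0_def a1_def a2_def a3_def coeff_pCons numeral_eq_Suc
        coeff_eq_0 split: nat.split)
  hence pp: "poly p x = a0 + a1 * x + a2 * x * x + a3 * x * x * x" for x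
    by (simp add: algebra_simps)
  have step: "a3 * (y * y + y * x + x * x) + a2 * (y + x) + a1 = y * x"
    if "i + 1 \<le> d" and xy: "y = \<theta> (i + 1)" "x = \<theta> i" for i x y
  proof -
    have "y \<noteq> x" using that \<theta>_eq_iff[of "i + 1" i] by simp
    have "poly p y - poly p x = y * x * (y - x)"
      using p(2) z_adj[of "i + 1" i] that by simp
    hence "(y - x) * (a3 * (y * y + y * x + x * x) + a2 * (y + x) + a1) = (y - x) * (y * x)"
      unfolding pp by (simp add: algebra_simps)
    thus ?thesis using \<open>y \<noteq> x\<close> by simp
  qed
  show ?thesis
  proof (intro exI allI impI)
    fix i assume i: "i + 2 \<le> d"
    define w where "w = \<theta> (i + 2)"
    define y where "y = \<theta> (i + 1)"
    define x where "x = \<theta> i"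
    have "w \<noteq> x" using i \<theta>_eq_iff[of "i + 2" i] by (simp add: w_def x_def)
    have 1: "a3 * (y * y + y * x + x * x) + a2 * (y + x) + a1 = y * x"
      using step[of i] i by (simp add: y_def x_def)
    have 2: "a3 * (w * w + w * y + y * y) + a2 * (w + y) + a1 = w * y"
      using step[of "i + 1"] i by (simp add: y_def w_def numeral_2_eq_2)
    have "(w - x) * (a3 * (w + y + x) + a2) = (w - x) * y"
      using arg_cong2[OF 2 1, of "(-)"] by (simp add: algebra_simps)
    hence "a3 * (w + y + x) + a2 = y" using \<open>w \<noteq> x\<close> by simp
    thus "a3 * (\<theta> (i + 2) + \<theta> (i + 1) + \<theta> i) + a2 = \<theta> (i + 1)"
      by (simp add: w_def y_def x_def)
  qed
qed

text \<open>For \<open>d \<le> 2\<close> the hypothesis on the ends is already the claim.  For larger \<open>d\<close> the leading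
constant of the recurrence is nonzero, because \<open>\<theta> 1 \<noteq> \<theta> 2\<close>, and one can divide by it.\<close>
lemma spectrum_symmetric:
  assumes ends: "\<theta> 1 + \<theta> (d - 1) = \<theta> 0 + \<theta> d" and i: "i \<le> d"
  shows "\<theta> i + \<theta> (d - i) = \<theta> 0 + \<theta> d"
proof (cases "d \<le> 2")
  case True
  hence "i = 0 \<or> i = 1 \<or> i = d" using i by linarith
  thus ?thesis using ends by (auto simp: add_ac)
next
  case False
  obtain a c where ac: "\<And>i. i + 2 \<le> d \<Longrightarrow> a * (\<theta> (i + 2) + \<theta> (i + 1) + \<theta> i) + c = \<theta> (i + 1)"
    using three_term_recurrence by blast
  have a0: "a \<noteq> 0"
  proof
    assume "a = 0"
    hence "\<theta> 1 = \<theta> 2" using ac[of 0] ac[of 1] False by (simp add: numeral_eq_Suc)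
    thus False using \<theta>_eq_iff[of 1 2] False by simp
  qed
  have "\<theta> (i + 2) + \<theta> i = (1 / a - 1) * \<theta> (i + 1) + (- c / a)" if "i + 2 \<le> d" for i
  proof -
    have "a * (\<theta> (i + 2) + \<theta> i) = \<theta> (i + 1) - a * \<theta> (i + 1) - c"
      using ac[OF that] by (simp add: algebra_simps)
    also have "\<dots> = a * ((1 / a - 1) * \<theta> (i + 1) + (- c / a))"
      using a0 by (simp add: algebra_simps)
    finally show ?thesis using a0 by (metis mult_cancel_left)
  qed
  thus ?thesis
    using symmetric_of_recurrence[of d \<theta> "1 / a - 1" "- c / a", OF _ _ ends _ i] False
      \<theta>_eq_iff[of "d - 1" 0] by simp
qed

end

text \<open>
The difference \<open>D\<close> of two such matrices is tridiagonal and maps \<open>1\<close>, \<open>x\<close>, \<open>x\<^sup>2\<close> to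
\<open>0\<close>, a constant \<open>c\<close>, and an affine polynomial.  The first row has only two entries, one of which is
zero by hypothesis; this forces the other one and \<open>c\<close> to vanish, and then the two entries of the last
row.  Thus the affine polynomial vanishes at \<open>\<theta> 0\<close> and \<open>\<theta> d\<close>, hence identically, and each
of the remaining rows is killed by a Vandermonde matrix.
\<close>
lemma leonard_matrix_unique:
  fixes b b' :: "nat \<Rightarrow> nat \<Rightarrow> 'k::field"
  assumes "leonard_matrix d \<theta> \<theta>s b" and "leonard_matrix d \<theta> \<theta>s b'"
    and first: "b 0 0 = b' 0 0" and ij: "i \<le> d" "j \<le> d"
  shows "b i j = b' i j"
proof -
  interpret B: leonard_matrix d \<theta> \<theta>s b by fact
  interpret B': leonard_matrix d \<theta> \<theta>s b' by fact
  define D where "D i j = b i j - b' i j" for i j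
  have D_sum: "(\<Sum>j\<le>d. D i j * g j) = (\<Sum>j\<le>d. b i j * g j) - (\<Sum>j\<le>d. b' i j * g j)" for i g
    by (simp add: D_def left_diff_distrib sum_subtractf)
  have D0: "(\<Sum>j\<le>d. D i j * 1) = 0" if "i \<le> d" for i
    unfolding D_sum using B.row_sum[OF that] B'.row_sum[OF that] by simp
  obtain c where D1: "\<forall>i\<le>d. (\<Sum>j\<le>d. D i j * \<theta> j) = c"
    using B.row_sum_1 B'.row_sum_1 unfolding D_sum by (metis add_diff_cancel_left)
  have firstrow: "(\<Sum>j\<le>d. D 0 j * g j) = D 0 0 * g 0 + D 0 1 * g 1" for g
    unfolding D_sum B.row_first B'.row_first by (simp add: D_def algebra_simps)
  have lastrow: "(\<Sum>j\<le>d. D d j * g j) = D d (d - 1) * g (d - 1) + D d d * g d" for g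
    unfolding D_sum B.row_last B'.row_last by (simp add: D_def algebra_simps)
  have midrow: "(\<Sum>j\<le>d. D i j * g j) = D i (i - 1) * g (i - 1) + D i i * g i + D i (i + 1) * g (i + 1)"
    if "0 < i" "i < d" for i g
    unfolding D_sum B.row_middle[OF that] B'.row_middle[OF that] by (simp add: D_def algebra_simps)
  have D00: "D 0 0 = 0" using first by (simp add: D_def)
  hence D01: "D 0 1 = 0" using D0[of 0] unfolding firstrow by simp
  hence c0: "c = 0" using D1[rule_format, of 0] D00 firstrow[of \<theta>] by simp
  have e1: "D d (d - 1) + D d d = 0" using D0[of d] unfolding lastrow by simp
  moreover have "D d (d - 1) * \<theta> (d - 1) + D d d * \<theta> d = 0" using D1 c0 lastrow[of \<theta>] by simp
  ultimately have "D d d * (\<theta> d - \<theta> (d - 1)) = 0"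
    by (metis add_eq_0_iff2 minus_mult_left mult.commute right_diff_distrib uminus_add_conv_diff)
  hence Ddd: "D d d = 0" using B.\<theta>_eq_iff[of d "d - 1"] B.d_pos by auto
  hence Ddd1: "D d (d - 1) = 0" using e1 by simp
  show ?thesis
  proof (cases "0 < i \<and> i < d")
    case False
    hence "i = 0 \<or> i = d" using ij by auto
    moreover have "D 0 j = 0"
    proof (cases "j \<le> 1")
      case True
      hence "j = 0 \<or> j = 1" by auto
      thus ?thesis using D00 D01 by blast
    next
      case False
      thus ?thesis using B.tridiagonal[of 0 j] B'.tridiagonal[of 0 j] ij by (simp add: D_def)
    qed
    moreover have "D d j = 0"
    proof (cases "d \<le> j + 1")
      case True
      hence "j = d - 1 \<or> j = d" using ij by auto
      thus ?thesis using Ddd Ddd1 by blast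
    next
      case False
      thus ?thesis using B.tridiagonal[of d j] B'.tridiagonal[of d j] ij by (simp add: D_def)
    qed
    ultimately show ?thesis by (auto simp: D_def)
  next
    case True
    hence d2: "2 \<le> d" by simp
    obtain r s where r: "\<forall>i\<le>d. (\<Sum>j\<le>d. b i j * (\<theta> j)\<^sup>2) = \<theta>s 2 * (\<theta> i)\<^sup>2 + r * \<theta> i + s"
      using B.row_sum_2[OF d2] by blast
    obtain r' s' where r': "\<forall>i\<le>d. (\<Sum>j\<le>d. b' i j * (\<theta> j)\<^sup>2) = \<theta>s 2 * (\<theta> i)\<^sup>2 + r' * \<theta> i + s'"
      using B'.row_sum_2[OF d2] by blast
    have D2: "(\<Sum>j\<le>d. D i j * (\<theta> j)\<^sup>2) = (r - r') * \<theta> i + (s - s')" if "i \<le> d" for i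
      unfolding D_sum using r r' that by (simp add: algebra_simps)
    have "(r - r') * \<theta> 0 + (s - s') = 0" using D2[of 0] D00 D01 unfolding firstrow by simp
    moreover have "(r - r') * \<theta> d + (s - s') = 0" using D2[of d] Ddd Ddd1 unfolding lastrow by simp
    ultimately have "(r - r') * \<theta> 0 = (r - r') * \<theta> d" by (metis add_right_cancel)
    hence "(r - r') * (\<theta> 0 - \<theta> d) = 0" by (simp add: right_diff_distrib)
    hence rr: "r - r' = 0" using B.\<theta>_eq_iff[of 0 d] B.d_pos by auto
    hence ss: "s - s' = 0" using \<open>(r - r') * \<theta> 0 + (s - s') = 0\<close> by simp
    define u where "u = D i (i - 1)"
    define m where "m = D i i"
    define w where "w = D i (i + 1)"
    define x where "x = \<theta> (i - 1)"
    define y where "y = \<theta> i"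
    define t where "t = \<theta> (i + 1)"
    have 0: "u + m + w = 0" using D0[of i] True unfolding u_def m_def w_def
      by (simp only: midrow) simp
    have 1: "u * x + m * y + w * t = 0"
      using D1 c0 True midrow[of i \<theta>] unfolding u_def m_def w_def x_def y_def t_def by simp
    have 2: "u * x\<^sup>2 + m * y\<^sup>2 + w * t\<^sup>2 = 0"
      using D2[of i] rr ss True midrow[of i "\<lambda>j. (\<theta> j)\<^sup>2"] unfolding u_def m_def w_def x_def y_def t_def by simp
    have ne: "x \<noteq> y" "y \<noteq> t" "x \<noteq> t"
      using True B.\<theta>_eq_iff[of "i - 1" i] B.\<theta>_eq_iff[of i "i + 1"] B.\<theta>_eq_iff[of "i - 1" "i + 1"]
      unfolding x_def y_def t_def by linarith+
    have u: "u = - m - w" using 0 by (simp add: algebra_simps eq_neg_iff_add_eq_0)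
    have 11: "m * (y - x) = - w * (t - x)" using 1 unfolding u by (simp add: algebra_simps add_eq_0_iff2)
    have "m * (y - x) * (y + x) + w * (t - x) * (t + x) = 0"
      using 2 unfolding u by (simp add: algebra_simps power2_eq_square)
    hence "w * (t - x) * (t - y) = 0" unfolding 11 by (simp add: algebra_simps)
    hence w0: "w = 0" using ne by auto
    hence m0: "m = 0" using 11 ne by auto
    have u0: "u = 0" using u w0 m0 by simp
    have "D i j = 0"
    proof (cases "i + 1 < j \<or> j + 1 < i")
      case True
      thus ?thesis using B.tridiagonal[of i j] B'.tridiagonal[of i j] ij by (simp add: D_def)
    next
      case False
      hence "j = i - 1 \<or> j = i \<or> j = i + 1" by linarith
      thus ?thesis using u0 m0 w0 by (auto simp: u_def m_def w_def)
    qed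
    thus ?thesis by (simp add: D_def)
  qed
qed

section \<open>Bases and traces\<close>

context algebra_module
begin

lemma act_zero_left: "act 0 v = 0"
  using act_add_left[of 0 0 v] by simp

lemma act_zero_right: "act x 0 = 0"
  using act_add_right[of x 0 0] by simp

lemma act_scale_right: "act x (scaleV c v) = scaleV c (act x v)"
proof -
  have "act x (scaleV c v) = act (x * scaleA c 1) v"
    by (simp add: act_mult act_scale act_one)
  thus ?thesis by (simp add: scale_mult_right act_scale)
qed

lemma act_sum_left: "act (\<Sum>i\<in>I. f i) v = (\<Sum>i\<in>I. act (f i) v)"
  by (induction I rule: infinite_finite_induct) (simp_all add: act_zero_left act_add_left)

lemma act_sum_right: "act x (\<Sum>i\<in>I. g i) = (\<Sum>i\<in>I. act x (g i))"
  by (induction I rule: infinite_finite_induct) (simp_all add: act_zero_right act_add_right)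

lemma act_minus_right: "act x (v - w) = act x v - act x w"
  using act_add_right[of x "v - w" w] by (simp add: algebra_simps)

lemma act_minus_left: "act (x - y) v = act x v - act y v"
  using act_add_left[of "x - y" y v] by (simp add: algebra_simps)

lemmas act_simps = act_zero_left act_zero_right act_scale_right act_sum_left act_sum_right
  act_minus_right act_minus_left act_add_left act_add_right act_mult act_one act_scale

lemma ordered_basis_span:
  assumes "ordered_basis scaleV d b" shows "\<exists>c. u = (\<Sum>i\<le>d. scaleV (c i) (b i))"
proof -
  have "u \<in> V.span (b ` {..d})" using assms by (simp add: ordered_basis_def)
  then obtain r where "u = (\<Sum>y\<in>b ` {..d}. scaleV (r y) y)" by (auto simp: V.span_finite)
  hence "u = (\<Sum>i\<le>d. scaleV (r (b i)) (b i))"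
    using assms by (simp add: ordered_basis_def sum.reindex)
  thus ?thesis by (rule exI[of _ "\<lambda>i. r (b i)"])
qed

lemma ordered_basis_zero:
  assumes b: "ordered_basis scaleV d b" and z: "(\<Sum>i\<le>d. scaleV (c i) (b i)) = 0" and i: "i \<le> d"
  shows "c i = 0"
proof -
  have inj: "inj_on b {..d}" using b by (simp add: ordered_basis_def)
  have "(\<Sum>y\<in>b ` {..d}. scaleV (c (the_inv_into {..d} b y)) y) = 0"
    using z by (simp add: sum.reindex[OF inj] the_inv_into_f_f[OF inj])
  moreover have "V.independent (b ` {..d})" using b by (simp add: ordered_basis_def)
  ultimately have "c (the_inv_into {..d} b (b i)) = 0"
    using i by (intro V.independentD[of "b ` {..d}" "b ` {..d}"]) auto
  thus ?thesis using i by (simp add: the_inv_into_f_f[OF inj])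
qed

lemma ordered_basis_unique:
  assumes b: "ordered_basis scaleV d b"
    and eq: "(\<Sum>i\<le>d. scaleV (c i) (b i)) = (\<Sum>i\<le>d. scaleV (c' i) (b i))" and i: "i \<le> d"
  shows "c i = c' i"
proof -
  have "(\<Sum>i\<le>d. scaleV (c i - c' i) (b i)) = 0"
    using eq by (simp add: V.scale_left_diff_distrib sum_subtractf)
  thus ?thesis using ordered_basis_zero[OF b _ i, of "\<lambda>i. c i - c' i"] by simp
qed

text \<open>Composition of two changes of coordinates is multiplication of their matrices.\<close>
lemma double_combination:
  "(\<Sum>j\<le>d. scaleV (c j) (\<Sum>i\<le>d. scaleV (P i j) (w i))) =
    (\<Sum>i\<le>d. scaleV (\<Sum>j\<le>d. P i j * c j) (w i))"
  unfolding V.scale_sum_right V.scale_sum_left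
  by (subst sum.swap) (simp add: mult.commute)

text \<open>With \<open>P\<close>, \<open>Q\<close> the mutually inverse transition matrices, \<open>P Y = Z P\<close> and the trace of
\<open>Y = Q P Y = Q Z P\<close> is that of \<open>Z P Q = Z\<close>.\<close>
lemma trace_basis_independent:
  assumes b: "ordered_basis scaleV d b" and Y: "represents scaleV act d b Y X"
    and w: "ordered_basis scaleV d w" and Z: "represents scaleV act d w Z X"
  shows "(\<Sum>i\<le>d. Y $$ (i, i)) = (\<Sum>i\<le>d. Z $$ (i, i))"
proof -
  have coords: "\<exists>P. \<forall>j. f j = (\<Sum>i\<le>d. scaleV (P i j) (g i))"
    if "ordered_basis scaleV d g" for f g :: "nat \<Rightarrow> 'v"
  proof -
    have "\<forall>j. \<exists>c. f j = (\<Sum>i\<le>d. scaleV (c i) (g i))" using ordered_basis_span[OF that] by blast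
    from choice[OF this] obtain C where "\<forall>j. f j = (\<Sum>i\<le>d. scaleV (C j i) (g i))" ..
    thus ?thesis by (intro exI[of _ "\<lambda>i j. C j i"])
  qed
  obtain P where P: "\<And>j. b j = (\<Sum>i\<le>d. scaleV (P i j) (w i))" using coords[OF w, of b] by blast
  obtain Q where Q: "\<And>j. w j = (\<Sum>i\<le>d. scaleV (Q i j) (b i))" using coords[OF b, of w] by blast
  have QP: "(\<Sum>k\<le>d. Q i k * P k j) = (if i = j then 1 else 0)" if "i \<le> d" "j \<le> d" for i j
  proof -
    have "(\<Sum>i\<le>d. scaleV (\<Sum>k\<le>d. Q i k * P k j) (b i)) =
        (\<Sum>k\<le>d. scaleV (P k j) (\<Sum>i\<le>d. scaleV (Q i k) (b i)))"
      by (rule double_combination[symmetric])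
    also have "\<dots> = b j" by (simp only: Q[symmetric] P[symmetric])
    also have "\<dots> = (\<Sum>i\<le>d. if i = j then b i else 0)" using that by simp
    also have "\<dots> = (\<Sum>i\<le>d. scaleV (if i = j then 1 else 0) (b i))" by (intro sum.cong) auto
    finally have "(\<Sum>i\<le>d. scaleV (\<Sum>k\<le>d. Q i k * P k j) (b i)) = \<dots>" .
    from ordered_basis_unique[OF b this that(1)] show ?thesis .
  qed
  have PQ: "(\<Sum>k\<le>d. P i k * Q k j) = (if i = j then 1 else 0)" if "i \<le> d" "j \<le> d" for i j
  proof -
    have "(\<Sum>i\<le>d. scaleV (\<Sum>k\<le>d. P i k * Q k j) (w i)) =
        (\<Sum>k\<le>d. scaleV (Q k j) (\<Sum>i\<le>d. scaleV (P i k) (w i)))"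
      by (rule double_combination[symmetric])
    also have "\<dots> = w j" by (simp only: Q[symmetric] P[symmetric])
    also have "\<dots> = (\<Sum>i\<le>d. if i = j then w i else 0)" using that by simp
    also have "\<dots> = (\<Sum>i\<le>d. scaleV (if i = j then 1 else 0) (w i))" by (intro sum.cong) auto
    finally have "(\<Sum>i\<le>d. scaleV (\<Sum>k\<le>d. P i k * Q k j) (w i)) = \<dots>" .
    from ordered_basis_unique[OF w this that(1)] show ?thesis .
  qed
  have PY: "(\<Sum>k\<le>d. P i k * Y $$ (k, j)) = (\<Sum>k\<le>d. Z $$ (i, k) * P k j)" if "i \<le> d" "j \<le> d" for i j
  proof -
    have "(\<Sum>i\<le>d. scaleV (\<Sum>k\<le>d. P i k * Y $$ (k, j)) (w i)) =
        (\<Sum>k\<le>d. scaleV (Y $$ (k, j)) (\<Sum>i\<le>d. scaleV (P i k) (w i)))"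
      by (rule double_combination[symmetric])
    also have "\<dots> = act X (b j)"
      using Y that by (simp only: P[symmetric]) (simp add: represents_def)
    also have "\<dots> = (\<Sum>k\<le>d. scaleV (P k j) (act X (w k)))"
      by (simp only: P[of j] act_sum_right act_scale_right)
    also have "\<dots> = (\<Sum>k\<le>d. scaleV (P k j) (\<Sum>i\<le>d. scaleV (Z $$ (i, k)) (w i)))"
      using Z by (intro sum.cong refl) (simp add: represents_def)
    also have "\<dots> = (\<Sum>i\<le>d. scaleV (\<Sum>k\<le>d. Z $$ (i, k) * P k j) (w i))"
      by (rule double_combination)
    finally have "(\<Sum>i\<le>d. scaleV (\<Sum>k\<le>d. P i k * Y $$ (k, j)) (w i)) =
        (\<Sum>i\<le>d. scaleV (\<Sum>k\<le>d. Z $$ (i, k) * P k j) (w i))" .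
    from ordered_basis_unique[OF w this that(1)] show ?thesis .
  qed
  have "(\<Sum>j\<le>d. Y $$ (j, j)) = (\<Sum>j\<le>d. \<Sum>k\<le>d. if k = j then Y $$ (k, j) else 0)"
    by simp
  also have "\<dots> = (\<Sum>j\<le>d. \<Sum>k\<le>d. (\<Sum>i\<le>d. Q j i * P i k) * Y $$ (k, j))"
    by (intro sum.cong refl) (simp add: QP)
  also have "\<dots> = (\<Sum>j\<le>d. \<Sum>k\<le>d. \<Sum>i\<le>d. Q j i * (P i k * Y $$ (k, j)))"
    by (simp only: sum_distrib_right mult.assoc)
  also have "\<dots> = (\<Sum>j\<le>d. \<Sum>i\<le>d. \<Sum>k\<le>d. Q j i * (P i k * Y $$ (k, j)))"
    by (intro sum.cong refl sum.swap)
  also have "\<dots> = (\<Sum>j\<le>d. \<Sum>i\<le>d. Q j i * (\<Sum>k\<le>d. Z $$ (i, k) * P k j))"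
    by (intro sum.cong refl) (simp add: sum_distrib_left[symmetric] PY)
  also have "\<dots> = (\<Sum>i\<le>d. \<Sum>j\<le>d. Q j i * (\<Sum>k\<le>d. Z $$ (i, k) * P k j))"
    by (rule sum.swap)
  also have "\<dots> = (\<Sum>i\<le>d. \<Sum>j\<le>d. \<Sum>k\<le>d. Z $$ (i, k) * (P k j * Q j i))"
    by (simp only: sum_distrib_left mult_ac)
  also have "\<dots> = (\<Sum>i\<le>d. \<Sum>k\<le>d. \<Sum>j\<le>d. Z $$ (i, k) * (P k j * Q j i))"
    by (intro sum.cong refl sum.swap)
  also have "\<dots> = (\<Sum>i\<le>d. \<Sum>k\<le>d. if k = i then Z $$ (i, k) else 0)"
    by (intro sum.cong refl) (simp add: sum_distrib_left[symmetric] PQ)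
  also have "\<dots> = (\<Sum>i\<le>d. Z $$ (i, i))"
    by simp
  finally show ?thesis .
qed

lemma algebra_trace_eq:
  assumes "ordered_basis scaleV d b" and "represents scaleV act d b Y X"
  shows "algebra_trace scaleV act d X = (\<Sum>i\<le>d. Y $$ (i, i))"
  unfolding algebra_trace_def
proof (rule the_equality)
  show "\<exists>v Z. ordered_basis scaleV d v \<and> represents scaleV act d v Z X \<and>
      (\<Sum>i\<le>d. Y $$ (i, i)) = (\<Sum>i\<le>d. Z $$ (i, i))"
    by (intro exI conjI) (rule assms refl)+
next
  fix t assume "\<exists>v Z. ordered_basis scaleV d v \<and> represents scaleV act d v Z X \<and>
      t = (\<Sum>i\<le>d. Z $$ (i, i))"
  then obtain v Z where "ordered_basis scaleV d v" "represents scaleV act d v Z X"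
    and t: "t = (\<Sum>i\<le>d. Z $$ (i, i))" by (elim exE conjE)
  thus "t = (\<Sum>i\<le>d. Y $$ (i, i))"
    unfolding t by (intro trace_basis_independent[OF _ _ assms])
qed

lemma independent_of_projections:
  fixes d :: nat
  assumes proj: "\<And>i k. i \<le> d \<Longrightarrow> k \<le> d \<Longrightarrow> act (E i) (b k) = (if i = k then b k else 0)"
    and ne: "\<And>k. k \<le> d \<Longrightarrow> b k \<noteq> 0"
  shows "inj_on b {..d}" and "V.independent (b ` {..d})"
proof -
  show inj: "inj_on b {..d}"
  proof (rule inj_onI)
    fix i j assume ij: "i \<in> {..d}" "j \<in> {..d}" "b i = b j"
    thus "i = j" using proj[of i j] proj[of i i] ne[of i] by (auto split: if_splits)
  qed
  show "V.independent (b ` {..d})"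
  proof (rule V.independent_if_scalars_zero)
    fix f y assume z: "(\<Sum>y\<in>b ` {..d}. scaleV (f y) y) = 0" and y: "y \<in> b ` {..d}"
    obtain k where k: "k \<le> d" "y = b k" using y by auto
    have "0 = act (E k) (\<Sum>i\<le>d. scaleV (f (b i)) (b i))"
      using z by (simp add: sum.reindex[OF inj] act_zero_right)
    also have "\<dots> = (\<Sum>i\<le>d. if i = k then scaleV (f (b k)) (b k) else 0)"
      unfolding act_sum_right using k by (intro sum.cong refl) (auto simp: act_scale_right proj)
    also have "\<dots> = scaleV (f (b k)) (b k)" using k by simp
    finally show "f y = 0" using k ne[of k] by simp
  qed simp
qed

end

section \<open>Irreducible modules over matrix algebras\<close>

locale faithful_module = algebra_module scaleA scaleV act
  for scaleA :: "'k::field \<Rightarrow> 'a::ring_1 \<Rightarrow> 'a"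
    and scaleV :: "'k \<Rightarrow> 'v::ab_group_add \<Rightarrow> 'v"
    and act :: "'a \<Rightarrow> 'v \<Rightarrow> 'v" +
  assumes faithful: "(\<And>v. act x v = act y v) \<Longrightarrow> x = y"

text \<open>
A matrix algebra is simple: if \<open>x\<close> has a nonzero entry at \<open>(p, q)\<close>, then the sum of
\<open>U r p * x * U q r\<close> over \<open>r\<close>, with \<open>U\<close> the matrix units, is a nonzero multiple of \<open>1\<close>.  Hence an
element that annihilates a nonzero module is zero.
\<close>
lemma faithful_of_matrix_algebra:
  fixes act :: "'a::ring_1 \<Rightarrow> 'v::ab_group_add \<Rightarrow> 'v"
  assumes "matrix_algebra scaleA d" and "irreducible_module scaleA scaleV act"
  shows "faithful_module scaleA scaleV act"
proof -
  interpret MA: matrix_algebra scaleA d by fact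
  interpret irreducible_module scaleA scaleV act by fact
  obtain f where bij: "bij_betw f UNIV (carrier_mat (d + 1) (d + 1))"
    and add: "\<And>x y. f (x + y) = f x + f y" and mult: "\<And>x y. f (x * y) = f x * f y"
    and one: "f 1 = 1\<^sub>m (d + 1)" and sc: "\<And>c x. f (scaleA c x) = c \<cdot>\<^sub>m f x"
    using MA.iso_Mat by blast
  have car: "f x \<in> carrier_mat (d + 1) (d + 1)" for x using bij by (auto simp: bij_betw_def)
  define g where "g x i j = f x $$ (i, j)" for x i j
  have g_eqI: "x = y" if "\<And>i j. i \<le> d \<Longrightarrow> j \<le> d \<Longrightarrow> g x i j = g y i j" for x y
  proof -
    have "f x = f y"
      by (rule eq_matI) (use that car[of x] car[of y] in \<open>auto simp: g_def\<close>)
    thus ?thesis using bij by (auto simp: bij_betw_def inj_def)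
  qed
  have g_add: "g (x + y) i j = g x i j + g y i j" if "i \<le> d" "j \<le> d" for x y i j
    using that car[of x] car[of y] by (simp add: g_def add)
  have g_scale: "g (scaleA c x) i j = c * g x i j" if "i \<le> d" "j \<le> d" for c x i j
    using that car[of x] by (simp add: g_def sc)
  have g_one: "g 1 i j = (if i = j then 1 else 0)" if "i \<le> d" "j \<le> d" for i j
    using that by (simp add: g_def one)
  have g_mult: "g (x * y) i j = (\<Sum>k\<le>d. g x i k * g y k j)" if "i \<le> d" "j \<le> d" for x y i j
  proof -
    have "{..d} = {0..<d + 1}" by auto
    thus ?thesis using that car[of x] car[of y]
      by (simp add: g_def mult scalar_prod_def del: sum.op_ivl_Suc)
  qed
  have g_zero: "g 0 i j = 0" if "i \<le> d" "j \<le> d" for i j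
    using g_scale[OF that, of 0 0] by simp
  have g_sum: "g (\<Sum>k\<in>K. h k) i j = (\<Sum>k\<in>K. g (h k) i j)" if "i \<le> d" "j \<le> d" for h K i j
    by (induction K rule: infinite_finite_induct) (simp_all add: g_zero g_add that)
  have "\<exists>u. \<forall>i\<le>d. \<forall>j\<le>d. g u i j = (if i = p \<and> j = q then 1 else 0)" for p q
  proof -
    have "mat (d + 1) (d + 1) (\<lambda>(i, j). if i = p \<and> j = q then 1 else 0) \<in> range f"
      using bij by (simp add: bij_betw_def)
    then obtain u where "f u = mat (d + 1) (d + 1) (\<lambda>(i, j). if i = p \<and> j = q then 1 else 0)" by auto
    thus ?thesis by (intro exI[of _ u]) (simp add: g_def)
  qed
  then obtain U where U: "\<And>p q i j. i \<le> d \<Longrightarrow> j \<le> d \<Longrightarrow> g (U p q) i j = (if i = p \<and> j = q then 1 else 0)"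
    by metis
  have zero: "x = 0" if x: "\<And>v. act x v = 0" for x
  proof (rule ccontr)
    assume "x \<noteq> 0"
    then obtain p q where pq: "p \<le> d" "q \<le> d" "g x p q \<noteq> 0"
      using g_eqI[of x 0] g_zero by metis
    have U_left: "g (U r p * y) i j = (if i = r then g y p j else 0)" if "i \<le> d" "j \<le> d" for r y i j
    proof -
      have "g (U r p * y) i j = (\<Sum>k\<le>d. if k = p then (if i = r then g y p j else 0) else 0)"
        unfolding g_mult[OF that] using that by (intro sum.cong refl) (simp add: U)
      thus ?thesis using pq by simp
    qed
    have U_right: "g (y * U q r) i j = (if j = r then g y i q else 0)" if "i \<le> d" "j \<le> d" for r y i j
    proof -
      have "g (y * U q r) i j = (\<Sum>k\<le>d. if k = q then (if j = r then g y i q else 0) else 0)"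
        unfolding g_mult[OF that] using that by (intro sum.cong refl) (simp add: U)
      thus ?thesis using pq by simp
    qed
    have "(\<Sum>r\<le>d. U r p * x * U q r) = scaleA (g x p q) 1"
      by (rule g_eqI) (use pq in \<open>simp add: g_sum g_scale g_one U_left U_right\<close>)
    hence "act (scaleA (g x p q) 1) v = 0" for v
      using x by (simp add: act_simps flip: \<open>_ = scaleA (g x p q) 1\<close>)
    hence "v = 0" for v :: 'v using pq by (simp add: act_scale act_one)
    thus False using nonzero by blast
  qed
  show ?thesis
  proof
    fix x y assume "\<And>v. act x v = act y v"
    hence "x - y = 0" by (intro zero) (simp add: act_minus_left)
    thus "x = y" by simp
  qed
qed

text \<open>The orbit of a nonzero vector under the algebra is a nonzero submodule.\<close>
lemma (in irreducible_module) irreducible_act_surj: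
  assumes "w \<noteq> 0" shows "\<exists>x. act x w = w'"
proof -
  have "V.subspace (range (\<lambda>x. act x w))"
  proof (rule V.subspaceI)
    show "0 \<in> range (\<lambda>x. act x w)" by (metis act_zero_left rangeI)
    show "a + c \<in> range (\<lambda>x. act x w)" if "a \<in> range (\<lambda>x. act x w)" "c \<in> range (\<lambda>x. act x w)" for a c
      using that by (auto simp flip: act_add_left)
    show "scaleV r a \<in> range (\<lambda>x. act x w)" if "a \<in> range (\<lambda>x. act x w)" for r a
      using that by (auto simp flip: act_scale)
  qed
  hence "range (\<lambda>x. act x w) = {0} \<or> range (\<lambda>x. act x w) = UNIV"
    by (rule irreducible) (auto simp flip: act_mult)
  moreover have "w \<in> range (\<lambda>x. act x w)" by (metis act_one rangeI)
  ultimately show ?thesis using assms by (metis UNIV_I image_iff singletonD)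
qed

section \<open>Frames of idempotents\<close>

text \<open>
What is used of a multiplicity-free element: a spectral decomposition into rank-one idempotents.
Freed from the product formula for the idempotents, the notion is visibly stable under reversal of
the order and affine change of the element.
\<close>
locale eigen_frame = faithful_module scaleA scaleV act
  for scaleA :: "'k::field \<Rightarrow> 'a::ring_1 \<Rightarrow> 'a"
    and scaleV :: "'k \<Rightarrow> 'v::ab_group_add \<Rightarrow> 'v"
    and act :: "'a \<Rightarrow> 'v \<Rightarrow> 'v" +
  fixes d :: nat and A :: 'a and \<theta> :: "nat \<Rightarrow> 'k" and E :: "nat \<Rightarrow> 'a"
  assumes inj: "inj_on \<theta> {..d}"
    and E_E: "i \<le> d \<Longrightarrow> j \<le> d \<Longrightarrow> E i * E j = (if i = j then E i else 0)"
    and E_sum: "(\<Sum>i\<le>d. E i) = 1"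
    and A_E: "i \<le> d \<Longrightarrow> A * E i = scaleA (\<theta> i) (E i)"
    and E_A: "i \<le> d \<Longrightarrow> E i * A = scaleA (\<theta> i) (E i)"
    and rank_one: "i \<le> d \<Longrightarrow> act (E i) w \<noteq> 0 \<Longrightarrow> \<exists>c. act (E i) w' = scaleV c (act (E i) w)"
begin

lemma \<theta>_eq_iff: "i \<le> d \<Longrightarrow> j \<le> d \<Longrightarrow> \<theta> i = \<theta> j \<longleftrightarrow> i = j"
  using inj by (auto simp: inj_on_def)

lemma act_E_E: "i \<le> d \<Longrightarrow> j \<le> d \<Longrightarrow> act (E i) (act (E j) w) = (if i = j then act (E i) w else 0)"
  using E_E by (simp add: act_zero_left flip: act_mult)

lemma act_A_E: "i \<le> d \<Longrightarrow> act A (act (E i) w) = scaleV (\<theta> i) (act (E i) w)"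
  using A_E by (simp add: act_scale flip: act_mult)

lemma act_E_A: "i \<le> d \<Longrightarrow> act (E i) (act A w) = scaleV (\<theta> i) (act (E i) w)"
  using E_A by (simp add: act_scale flip: act_mult)

lemma decompose: "(\<Sum>i\<le>d. act (E i) w) = w"
  using E_sum by (simp add: act_one flip: act_sum_left)

lemma eq_by_components: "(\<And>i. i \<le> d \<Longrightarrow> act (E i) w = act (E i) w') \<Longrightarrow> w = w'"
  using decompose[of w] decompose[of w'] by (metis (no_types, lifting) atMost_iff sum.cong)

lemma component_sum:
  "k \<le> d \<Longrightarrow> act (E k) (\<Sum>i\<le>d. scaleV (c i) (act (E i) w)) = scaleV (c k) (act (E k) w)"
proof -
  assume k: "k \<le> d"
  have "act (E k) (\<Sum>i\<le>d. scaleV (c i) (act (E i) w)) =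
      (\<Sum>i\<le>d. if i = k then scaleV (c k) (act (E k) w) else 0)"
    unfolding act_sum_right using k
    by (intro sum.cong refl) (simp add: act_scale_right act_E_E)
  thus ?thesis using k by simp
qed

text \<open>A rank-one idempotent compresses the algebra to the scalars.\<close>
lemma corner_scalar:
  assumes "i \<le> d" shows "\<exists>c. E i * x * E i = scaleA c (E i)"
proof (cases "\<exists>w. act (E i) w \<noteq> 0")
  case False
  hence "E i * x * E i = scaleA 0 (E i)" by (intro faithful) (simp add: act_simps)
  thus ?thesis by blast
next
  case True
  then obtain w where w: "act (E i) w \<noteq> 0" by blast
  obtain c where c: "act (E i) (act (x * E i) w) = scaleV c (act (E i) w)"
    using rank_one[OF assms w] by blast
  have "act (E i * x * E i) u = act (scaleA c (E i)) u" for u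
  proof -
    obtain c' where c': "act (E i) u = scaleV c' (act (E i) w)" using rank_one[OF assms w] by blast
    show ?thesis using c by (simp add: act_mult act_scale c' act_scale_right V.scale_left_commute)
  qed
  thus ?thesis using faithful by blast
qed

lemma reverse: "eigen_frame scaleA scaleV act d A (\<lambda>i. \<theta> (d - i)) (\<lambda>i. E (d - i))"
proof
  show "inj_on (\<lambda>i. \<theta> (d - i)) {..d}" using \<theta>_eq_iff by (auto simp: inj_on_def)
  have "(\<Sum>i\<le>d. E (d - i)) = (\<Sum>i\<le>d. E i)"
    by (rule sum.reindex_bij_witness[of _ "\<lambda>i. d - i" "\<lambda>i. d - i"]) auto
  thus "(\<Sum>i\<le>d. E (d - i)) = 1" using E_sum by simp
qed (auto simp: E_E A_E E_A intro: rank_one)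

lemma affine:
  assumes "\<xi> \<noteq> 0" and \<theta>': "\<And>i. i \<le> d \<Longrightarrow> \<theta>' i = \<xi> * \<theta> i + \<zeta>"
  shows "eigen_frame scaleA scaleV act d (scaleA \<xi> A + scaleA \<zeta> 1) \<theta>' E"
proof
  show "inj_on \<theta>' {..d}" using inj assms by (auto simp: inj_on_def)
  show "(scaleA \<xi> A + scaleA \<zeta> 1) * E i = scaleA (\<theta>' i) (E i)" if "i \<le> d" for i
    using that by (simp add: \<theta>' distrib_right scale_mult_left A_E scale_left_distrib)
  show "E i * (scaleA \<xi> A + scaleA \<zeta> 1) = scaleA (\<theta>' i) (E i)" if "i \<le> d" for i
    using that by (simp add: \<theta>' distrib_left scale_mult_right E_A scale_left_distrib)
qed (auto simp: E_E E_sum intro: rank_one)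

end

text \<open>
A Leonard system together with its eigenvalue sequences.  The conditions are symmetric in the two
generators (\<open>dual\<close>), so that each of the lemmas below also yields its dual and, by \<open>reverse\<close>, its
versions for the reversed orderings.
\<close>
locale leonard_frame = faithful_module scaleA scaleV act +
  X: eigen_frame scaleA scaleV act d A \<theta> E +
  Y: eigen_frame scaleA scaleV act d As \<theta>s Es
  for scaleA :: "'k::field \<Rightarrow> 'a::ring_1 \<Rightarrow> 'a"
    and scaleV :: "'k \<Rightarrow> 'v::ab_group_add \<Rightarrow> 'v"
    and act :: "'a \<Rightarrow> 'v \<Rightarrow> 'v"
    and d A \<theta> E As \<theta>s Es +
  assumes d_pos: "1 \<le> d"
    and E_far: "i \<le> d \<Longrightarrow> j \<le> d \<Longrightarrow> i + 1 < j \<or> j + 1 < i \<Longrightarrow> E i * As * E j = 0"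
    and E_adj: "i \<le> d \<Longrightarrow> j \<le> d \<Longrightarrow> i = j + 1 \<or> j = i + 1 \<Longrightarrow> E i * As * E j \<noteq> 0"
    and Es_far: "i \<le> d \<Longrightarrow> j \<le> d \<Longrightarrow> i + 1 < j \<or> j + 1 < i \<Longrightarrow> Es i * A * Es j = 0"
    and Es_adj: "i \<le> d \<Longrightarrow> j \<le> d \<Longrightarrow> i = j + 1 \<or> j = i + 1 \<Longrightarrow> Es i * A * Es j \<noteq> 0"
begin

lemma dual: "leonard_frame scaleA scaleV act d As \<theta>s Es A \<theta> E"
  by unfold_locales (use d_pos E_far E_adj Es_far Es_adj in auto)

lemma reverse: "leonard_frame scaleA scaleV act d A \<theta> E As (\<lambda>i. \<theta>s (d - i)) (\<lambda>i. Es (d - i))"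
proof -
  interpret R: eigen_frame scaleA scaleV act d As "\<lambda>i. \<theta>s (d - i)" "\<lambda>i. Es (d - i)" by (rule Y.reverse)
  show ?thesis
  proof
    show "Es (d - i) * A * Es (d - j) = 0" if "i \<le> d" "j \<le> d" "i + 1 < j \<or> j + 1 < i" for i j
      using that by (intro Es_far) auto
    show "Es (d - i) * A * Es (d - j) \<noteq> 0" if "i \<le> d" "j \<le> d" "i = j + 1 \<or> j = i + 1" for i j
      using that by (intro Es_adj) auto
  qed (use d_pos E_far E_adj in auto)
qed

lemma E_affine_E:
  "i \<le> d \<Longrightarrow> j \<le> d \<Longrightarrow> i \<noteq> j \<Longrightarrow>
    E i * (scaleA \<xi> As + scaleA \<zeta> 1) * E j = scaleA \<xi> (E i * As * E j)"
  by (simp add: distrib_left distrib_right scale_mult_left scale_mult_right X.E_E)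

lemma affine:
  assumes "\<xi> \<noteq> 0" and \<theta>': "\<And>i. i \<le> d \<Longrightarrow> \<theta>s' i = \<xi> * \<theta>s i + \<zeta>"
  shows "leonard_frame scaleA scaleV act d A \<theta> E (scaleA \<xi> As + scaleA \<zeta> 1) \<theta>s' Es"
proof -
  interpret R: eigen_frame scaleA scaleV act d "scaleA \<xi> As + scaleA \<zeta> 1" \<theta>s' Es
    by (rule Y.affine[OF assms])
  show ?thesis
  proof
    show "E i * (scaleA \<xi> As + scaleA \<zeta> 1) * E j = 0" if "i \<le> d" "j \<le> d" "i + 1 < j \<or> j + 1 < i" for i j
      using that E_affine_E[of i j] E_far[of i j] by auto
    show "E i * (scaleA \<xi> As + scaleA \<zeta> 1) * E j \<noteq> 0" if "i \<le> d" "j \<le> d" "i = j + 1 \<or> j = i + 1" for i j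
      using that E_affine_E[of i j] E_adj[of i j] assms(1) by auto
  qed (use d_pos Es_far Es_adj in auto)
qed

lemma act_Es_adj:
  assumes "i \<le> d" "j \<le> d" "i = j + 1 \<or> j = i + 1" "act (Es j) w \<noteq> 0"
  shows "act (Es i * A * Es j) w \<noteq> 0"
proof
  assume 0: "act (Es i * A * Es j) w = 0"
  have "act (Es i * A * Es j) u = act 0 u" for u
  proof -
    obtain c where "act (Es j) u = scaleV c (act (Es j) w)" using Y.rank_one[OF assms(2,4)] by blast
    hence "act (Es i * A * Es j) u = scaleV c (act (Es i * A * Es j) w)"
      by (simp add: act_mult act_scale_right)
    thus ?thesis using 0 by (simp add: act_zero_left)
  qed
  hence "Es i * A * Es j = 0" by (rule faithful)
  thus False using Es_adj[OF assms(1-3)] by simp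
qed

lemma act_Es_A: "act (Es k) (act A w) = (\<Sum>j\<le>d. act (Es k * A * Es j) w)"
proof -
  have "act (Es k) (act A w) = act (Es k) (act A (\<Sum>j\<le>d. act (Es j) w))" by (simp only: Y.decompose)
  thus ?thesis by (simp add: act_sum_right act_mult)
qed

text \<open>The components of an eigenvector of \<open>A\<close> along the \<open>Es k\<close> satisfy a three-term recursion whose
off-diagonal coefficients are invertible; if the component at \<open>0\<close> vanishes, then so do all of them.\<close>
lemma eigenvector_first_component:
  assumes "w \<noteq> 0" and Aw: "act A w = scaleV t w"
  shows "act (Es 0) w \<noteq> 0"
proof
  assume 0: "act (Es 0) w = 0"
  have "\<forall>j\<le>k. act (Es j) w = 0" if "k \<le> d" for k
    using that
  proof (induction k)
    case 0
    thus ?case using \<open>act (Es 0) w = 0\<close> by simp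
  next
    case (Suc k)
    hence IH: "\<forall>j\<le>k. act (Es j) w = 0" and k: "k \<le> d" by auto
    have "act (Es k * A * Es j) w = 0" if "j \<le> d" "j \<noteq> Suc k" for j
    proof (cases "j \<le> k")
      case True
      thus ?thesis using IH by (simp add: act_mult act_zero_right)
    next
      case False
      thus ?thesis using Es_far[of k j] that k by (simp add: act_zero_left)
    qed
    hence "(\<Sum>j\<le>d. act (Es k * A * Es j) w) = (\<Sum>j\<in>{Suc k}. act (Es k * A * Es j) w)"
      using Suc.prems by (intro sum.mono_neutral_right) auto
    hence "act (Es k * A * Es (Suc k)) w = act (Es k) (act A w)"
      by (simp add: act_Es_A)
    also have "\<dots> = 0" using IH by (simp add: Aw act_scale_right)
    finally have "act (Es (Suc k)) w = 0" using act_Es_adj[of k "Suc k" w] Suc.prems by auto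
    thus ?case using IH by (auto simp: le_Suc_eq)
  qed
  from this[of d] have "w = 0" using Y.decompose[of w] by simp
  thus False using \<open>w \<noteq> 0\<close> by simp
qed

lemma exists_cyclic: "\<exists>v. v \<noteq> 0 \<and> act (Es 0) v = v"
proof -
  have "\<exists>w. act (Es 0) w \<noteq> 0"
  proof (rule ccontr)
    assume "\<nexists>w. act (Es 0) w \<noteq> 0"
    hence "Es 1 * A * Es 0 = 0" by (intro faithful) (simp add: act_mult act_zero_right act_zero_left)
    thus False using Es_adj[of 1 0] d_pos by simp
  qed
  thus ?thesis using Y.act_E_E[of 0 0] by (metis le0)
qed

end

section \<open>Vectors as polynomials in the first generator\<close>

locale leonard_frame_vector = leonard_frame scaleA scaleV act d A \<theta> E As \<theta>s Es
  for scaleA :: "'k::field \<Rightarrow> 'a::ring_1 \<Rightarrow> 'a"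
    and scaleV :: "'k \<Rightarrow> 'v::ab_group_add \<Rightarrow> 'v"
    and act :: "'a \<Rightarrow> 'v \<Rightarrow> 'v"
    and d A \<theta> E As \<theta>s Es +
  fixes v :: 'v
  assumes v_ne: "v \<noteq> 0" and Es_v: "act (Es 0) v = v"
begin

text \<open>This is \<open>p(A) v\<close>, written in the eigenbasis of \<open>A\<close>.\<close>
definition poly_vec :: "'k poly \<Rightarrow> 'v" where
  "poly_vec p = (\<Sum>i\<le>d. scaleV (poly p (\<theta> i)) (act (E i) v))"

lemma poly_vec_component: "k \<le> d \<Longrightarrow> act (E k) (poly_vec p) = scaleV (poly p (\<theta> k)) (act (E k) v)"
  unfolding poly_vec_def by (rule X.component_sum)

lemma poly_vec_0: "poly_vec 0 = 0"
  by (simp add: poly_vec_def)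

lemma poly_vec_pCons: "poly_vec (pCons a p) = scaleV a v + act A (poly_vec p)"
  by (rule X.eq_by_components)
    (simp add: poly_vec_component act_add_right act_scale_right X.act_E_A V.scale_left_distrib)

lemma poly_vec_const: "poly_vec [:a:] = scaleV a v"
  by (simp add: poly_vec_pCons poly_vec_0 act_zero_right)

lemma poly_vec_smult: "poly_vec (smult c p) = scaleV c (poly_vec p)"
  by (simp add: poly_vec_def V.scale_sum_right)

text \<open>Multiplication by \<open>A\<close> moves the \<open>Es\<close>-support up by exactly one step, because \<open>A\<close> is
irreducible tridiagonal for the \<open>Es k\<close>.  So the degree of \<open>p\<close> is the position of the last nonzero
component of \<open>p(A) v\<close>.\<close>
lemma poly_vec_filtration:
  "(\<forall>k\<le>d. degree p < k \<longrightarrow> act (Es k) (poly_vec p) = 0) \<and>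
    (p \<noteq> 0 \<longrightarrow> degree p \<le> d \<longrightarrow> act (Es (degree p)) (poly_vec p) \<noteq> 0)"
proof (induction p)
  case 0
  show ?case by (simp add: poly_vec_0 act_zero_right)
next
  case (pCons a p)
  have Es_k_v: "act (Es k) v = 0" if "k \<le> d" "0 < k" for k
    using Y.act_E_E[of k 0 v] that by (simp add: Es_v)
  show ?case
  proof (cases "p = 0")
    case True
    thus ?thesis using pCons.hyps Es_k_v by (simp add: poly_vec_const act_scale_right Es_v v_ne)
  next
    case False
    define n where "n = degree p"
    have dn: "degree (pCons a p) = Suc n" using False by (simp add: n_def)
    have low: "act (Es k) (poly_vec p) = 0" if "k \<le> d" "n < k" for k
      using pCons.IH that by (simp add: n_def)
    have step: "act (Es k) (poly_vec (pCons a p)) = act (Es k * A * Es n) (poly_vec p)"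
      if k: "k \<le> d" "n < k" for k
    proof -
      have "act (Es k * A * Es j) (poly_vec p) = 0" if "j \<le> d" "j \<noteq> n" for j
      proof (cases "n < j")
        case True
        thus ?thesis using low that by (simp add: act_mult act_zero_right)
      next
        case False
        thus ?thesis using Es_far[of k j] that k by (simp add: act_zero_left)
      qed
      hence "(\<Sum>j\<le>d. act (Es k * A * Es j) (poly_vec p)) = (\<Sum>j\<in>{n}. act (Es k * A * Es j) (poly_vec p))"
        using k by (intro sum.mono_neutral_right) auto
      thus ?thesis
        using k Es_k_v[of k] by (simp add: poly_vec_pCons act_add_right act_scale_right act_Es_A)
    qed
    have "act (Es k) (poly_vec (pCons a p)) = 0" if "k \<le> d" "Suc n < k" for k
      using step[of k] Es_far[of k n] that by (simp add: act_zero_left)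
    moreover have "act (Es (Suc n)) (poly_vec (pCons a p)) \<noteq> 0" if "Suc n \<le> d"
    proof -
      have "act (Es n) (poly_vec p) \<noteq> 0" using pCons.IH False that by (simp add: n_def)
      thus ?thesis using step[of "Suc n"] act_Es_adj[of "Suc n" n "poly_vec p"] that by simp
    qed
    ultimately show ?thesis unfolding dn by blast
  qed
qed

lemma poly_vec_above: "k \<le> d \<Longrightarrow> degree p < k \<Longrightarrow> act (Es k) (poly_vec p) = 0"
  using poly_vec_filtration by blast

lemma poly_vec_top: "p \<noteq> 0 \<Longrightarrow> degree p \<le> d \<Longrightarrow> act (Es (degree p)) (poly_vec p) \<noteq> 0"
  using poly_vec_filtration by blast

text \<open>If \<open>E i v = 0\<close>, then the polynomial of degree \<open>d\<close> with roots \<open>\<theta> j\<close>, \<open>j \<noteq> i\<close>, would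
annihilate \<open>v\<close>, although its component at \<open>d\<close> is nonzero.\<close>
lemma E_v_ne: assumes i: "i \<le> d" shows "act (E i) v \<noteq> 0"
proof
  assume 0: "act (E i) v = 0"
  define p where "p = (\<Prod>j\<in>{..d} - {i}. [:- \<theta> j, 1:])"
  have deg: "degree p = d"
    unfolding p_def using i by (subst degree_prod_eq_sum_degree) auto
  have p0: "p \<noteq> 0" unfolding p_def by (auto simp: prod_zero_iff)
  have "act (E k) (poly_vec p) = act (E k) 0" if k: "k \<le> d" for k
  proof (cases "k = i")
    case True
    thus ?thesis using 0 k by (simp add: poly_vec_component act_zero_right)
  next
    case False
    hence "poly p (\<theta> k) = 0" using k unfolding p_def poly_prod by (intro prod_zero) auto
    thus ?thesis using k by (simp add: poly_vec_component act_zero_right)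
  qed
  hence "poly_vec p = 0" by (rule X.eq_by_components)
  thus False using poly_vec_top[OF p0] deg by (simp add: act_zero_right)
qed

lemma poly_vec_surj: "\<exists>p. degree p \<le> d \<and> w = poly_vec p"
proof -
  have "\<forall>i. \<exists>c. i \<le> d \<longrightarrow> act (E i) w = scaleV c (act (E i) v)"
    using X.rank_one E_v_ne by blast
  then obtain c where c: "\<And>i. i \<le> d \<Longrightarrow> act (E i) w = scaleV (c i) (act (E i) v)" by metis
  obtain p where p: "degree p \<le> d" "\<forall>i\<le>d. poly p (\<theta> i) = c i" using interpolation[OF X.inj] by blast
  have "w = poly_vec p" by (rule X.eq_by_components) (simp add: poly_vec_component c p(2))
  thus ?thesis using p(1) by blast
qed

lemma poly_vec_below:
  assumes "\<And>k. k \<le> d \<Longrightarrow> m \<le> k \<Longrightarrow> act (Es k) w = 0"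
  shows "\<exists>p. (\<forall>n\<ge>m. coeff p n = 0) \<and> w = poly_vec p"
proof -
  obtain p where p: "degree p \<le> d" "w = poly_vec p" using poly_vec_surj by blast
  have "p = 0 \<or> degree p < m" using poly_vec_top[of p] assms[of "degree p"] p by (meson not_less)
  hence "\<forall>n\<ge>m. coeff p n = 0" by (auto intro: coeff_eq_0)
  thus ?thesis using p(2) by blast
qed

text \<open>By the filtration, \<open>p(A) v\<close> is supported on \<open>Es 0, ..., Es k\<close>, and \<open>As - \<theta>s k\<close> removes the
component at \<open>k\<close>.\<close>
lemma As_triangular:
  assumes p: "degree p \<le> k" and k: "k \<le> d"
  shows "\<exists>q. (\<forall>n\<ge>k. coeff q n = 0) \<and> act As (poly_vec p) = scaleV (\<theta>s k) (poly_vec p) + poly_vec q"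
proof -
  define w where "w = act As (poly_vec p) - scaleV (\<theta>s k) (poly_vec p)"
  have "act (Es j) w = 0" if "j \<le> d" "k \<le> j" for j
  proof -
    have "act (Es j) w = scaleV (\<theta>s j - \<theta>s k) (act (Es j) (poly_vec p))"
      using that by (simp add: w_def act_minus_right act_scale_right Y.act_E_A V.scale_left_diff_distrib)
    also have "\<dots> = 0" using that poly_vec_above[of j p] p by (cases "j = k") auto
    finally show ?thesis .
  qed
  then obtain q where "\<forall>n\<ge>k. coeff q n = 0" "w = poly_vec q" using poly_vec_below by blast
  thus ?thesis by (intro exI[of _ q]) (simp add: w_def algebra_simps)
qed

text \<open>The coefficient exists and is unique because the image of \<open>E i\<close> is the line through
\<open>act (E i) v\<close>.\<close>
definition entry :: "nat \<Rightarrow> nat \<Rightarrow> 'k" where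
  "entry i j = (SOME c. act (E i * As * E j) v = scaleV c (act (E i) v))"

lemma entry: "i \<le> d \<Longrightarrow> act (E i * As * E j) v = scaleV (entry i j) (act (E i) v)"
  unfolding entry_def by (rule someI_ex) (use X.rank_one E_v_ne in \<open>auto simp: act_mult\<close>)

lemma entry_unique: "i \<le> d \<Longrightarrow> act (E i * As * E j) v = scaleV c (act (E i) v) \<Longrightarrow> entry i j = c"
  using entry[of i j] E_v_ne by auto

lemma As_poly_vec_component:
  assumes "i \<le> d"
  shows "act (E i) (act As (poly_vec p)) = scaleV (\<Sum>j\<le>d. entry i j * poly p (\<theta> j)) (act (E i) v)"
proof -
  have "act (E i) (act As (poly_vec p)) = (\<Sum>j\<le>d. scaleV (poly p (\<theta> j)) (act (E i * As * E j) v))"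
    by (simp add: poly_vec_def act_sum_right act_scale_right act_mult)
  also have "\<dots> = scaleV (\<Sum>j\<le>d. entry i j * poly p (\<theta> j)) (act (E i) v)"
    by (simp add: entry[OF assms] V.scale_sum_left mult.commute)
  finally show ?thesis .
qed

lemma As_poly_vec_entries:
  assumes "act As (poly_vec p) = scaleV c (poly_vec p) + poly_vec q" "i \<le> d"
  shows "(\<Sum>j\<le>d. entry i j * poly p (\<theta> j)) = c * poly p (\<theta> i) + poly q (\<theta> i)"
proof -
  have "scaleV (\<Sum>j\<le>d. entry i j * poly p (\<theta> j)) (act (E i) v) =
      scaleV (c * poly p (\<theta> i) + poly q (\<theta> i)) (act (E i) v)"
    using As_poly_vec_component[OF assms(2), of p] assms
    by (simp add: act_add_right act_scale_right poly_vec_component V.scale_left_distrib)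
  thus ?thesis using E_v_ne[OF assms(2)] by simp
qed

sublocale M: leonard_matrix d \<theta> \<theta>s entry
proof
  show "entry i j = 0" if "i \<le> d" "j \<le> d" "i + 1 < j \<or> j + 1 < i" for i j
    using that E_far[of i j] by (intro entry_unique) (auto simp: act_zero_left)
  show "\<exists>q. (\<forall>n\<ge>k. coeff q n = 0) \<and>
      (\<forall>i\<le>d. (\<Sum>j\<le>d. entry i j * poly p (\<theta> j)) = \<theta>s k * poly p (\<theta> i) + poly q (\<theta> i))"
    if "degree p \<le> k" "k \<le> d" for p k
    using As_triangular[OF that] As_poly_vec_entries by blast
qed (use d_pos X.inj Y.inj in auto)

text \<open>
Triangularity gives \<open>As (A - \<theta> 0) v = \<theta>s 1 (A - \<theta> 0) v + c v\<close> for a scalar \<open>c\<close>, which is the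
first split coefficient.  Both sides of the claim are this \<open>c\<close>: the right-hand side is read off by
applying \<open>Es 0\<close>, the left-hand side by applying \<open>E 0\<close>.
\<close>
lemma corner_relation_cyclic:
  assumes x: "E 0 * As * E 0 = scaleA x (E 0)" and a: "Es 0 * A * Es 0 = scaleA a (Es 0)"
  shows "(\<theta> 0 - \<theta> 1) * (x - \<theta>s 0) = (\<theta>s 0 - \<theta>s 1) * (a - \<theta> 0)"
proof -
  have e00: "entry 0 0 = x" using x by (intro entry_unique) (auto simp: act_scale)
  have Av: "act (Es 0) (act A v) = scaleV a v"
    using arg_cong[OF a, of "\<lambda>z. act z v"] by (simp add: act_mult act_scale Es_v)
  define p where "p = [:- \<theta> 0, 1:]"
  obtain q where q: "\<forall>n\<ge>1. coeff q n = 0" "act As (poly_vec p) = scaleV (\<theta>s 1) (poly_vec p) + poly_vec q"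
    using As_triangular[of p 1] d_pos by (auto simp: p_def)
  define c where "c = coeff q 0"
  have qc: "q = [:c:]" using q(1) by (auto intro!: poly_eqI simp: c_def coeff_pCons split: nat.split)
  have pvp: "poly_vec p = act A v - scaleV (\<theta> 0) v"
    by (simp add: p_def poly_vec_pCons poly_vec_0 act_zero_right)
  have Ep: "act (Es 0) (poly_vec p) = scaleV (a - \<theta> 0) v"
    by (simp add: pvp act_minus_right act_scale_right Av Es_v V.scale_left_diff_distrib)
  have "scaleV (\<theta>s 0) (act (Es 0) (poly_vec p)) = act (Es 0) (scaleV (\<theta>s 1) (poly_vec p) + poly_vec q)"
    using Y.act_E_A[of 0 "poly_vec p"] q(2) by simp
  hence "scaleV (\<theta>s 0 * (a - \<theta> 0)) v = scaleV (\<theta>s 1 * (a - \<theta> 0) + c) v"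
    by (simp add: qc act_add_right act_scale_right Ep poly_vec_const Es_v V.scale_left_distrib)
  hence 1: "\<theta>s 0 * (a - \<theta> 0) = \<theta>s 1 * (a - \<theta> 0) + c" using v_ne by simp
  have 2: "entry 0 1 * (\<theta> 1 - \<theta> 0) = c"
    using As_poly_vec_entries[OF q(2), of 0] M.row_first[of "\<lambda>j. poly p (\<theta> j)"] by (simp add: p_def qc)
  have e01: "entry 0 1 = \<theta>s 0 - x"
    using M.row_sum[of 0] M.row_first[of "\<lambda>_. 1"] by (simp add: e00 algebra_simps)
  have "(\<theta> 0 - \<theta> 1) * (x - \<theta>s 0) = entry 0 1 * (\<theta> 1 - \<theta> 0)"
    unfolding e01 by (simp add: algebra_simps)
  also have "\<dots> = (\<theta>s 0 - \<theta>s 1) * (a - \<theta> 0)" using 1 2 by (simp add: algebra_simps)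
  finally show ?thesis .
qed

text \<open>These are the partial products of the characteristic polynomial that start from the last
eigenvalue, as in the second split sequence.\<close>
definition tail_poly :: "nat \<Rightarrow> 'k poly" where
  "tail_poly n = (\<Prod>h<n. [:- \<theta> (d - h), 1:])"

text \<open>
The vector \<open>tail_poly d (A) v\<close> is a multiple of \<open>E 0 v\<close>, so \<open>As - \<theta>s d\<close> maps it to a vector
without components along \<open>E 2, ..., E d\<close>.  By triangularity the result is \<open>q(A) v\<close> with
\<open>degree q < d\<close>, so \<open>q\<close> is a multiple of \<open>tail_poly (d - 1)\<close>.  Its coefficient is found by
applying \<open>E 0\<close>; applying \<open>Es 0\<close> then relates the two traces \<open>m\<close> and \<open>m'\<close>.
\<close>
lemma last_second_split_coefficient:
  assumes x: "E 0 * As * E 0 = scaleA x (E 0)"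
    and m: "act (Es 0) (poly_vec (tail_poly d)) = scaleV m v"
    and m': "act (Es 0) (poly_vec (tail_poly (d - 1))) = scaleV m' v"
  shows "(\<theta>s 0 - \<theta>s d) * m = (\<theta> 0 - \<theta> 1) * (x - \<theta>s d) * m'" and "m' \<noteq> 0"
proof -
  have e00: "entry 0 0 = x" using x by (intro entry_unique) (auto simp: act_scale)
  have tail_poly_d: "tail_poly d = [:- \<theta> 1, 1:] * tail_poly (d - 1)"
    using prod.lessThan_Suc[of "\<lambda>h. [:- \<theta> (d - h), 1:]" "d - 1"] d_pos
    by (simp add: tail_poly_def mult.commute)
  have root: "poly (tail_poly d) (\<theta> j) = 0" if "1 \<le> j" "j \<le> d" for j
    unfolding tail_poly_def poly_prod by (rule prod_zero) (use that in \<open>auto intro!: bexI[of _ "d - j"]\<close>)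
  have root': "poly (tail_poly (d - 1)) (\<theta> j) = 0" if "2 \<le> j" "j \<le> d" for j
    unfolding tail_poly_def poly_prod by (rule prod_zero) (use that in \<open>auto intro!: bexI[of _ "d - j"]\<close>)
  have r0: "poly (tail_poly d) (\<theta> 0) = (\<theta> 0 - \<theta> 1) * poly (tail_poly (d - 1)) (\<theta> 0)"
    by (simp add: tail_poly_d algebra_simps)
  have r00: "poly (tail_poly d) (\<theta> 0) \<noteq> 0"
    unfolding tail_poly_def poly_prod using X.\<theta>_eq_iff by (auto simp: prod_zero_iff)
  have deg: "degree (tail_poly n) = n" for n
    unfolding tail_poly_def by (subst degree_prod_eq_sum_degree) auto
  define c where "c = (\<theta> 0 - \<theta> 1) * (x - \<theta>s d)"
  obtain q where q: "\<forall>n\<ge>d. coeff q n = 0" "act As (poly_vec (tail_poly d)) = scaleV (\<theta>s d) (poly_vec (tail_poly d)) + poly_vec q"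
    using As_triangular[of "tail_poly d" d] deg by auto
  have row: "entry i 0 * poly (tail_poly d) (\<theta> 0) = \<theta>s d * poly (tail_poly d) (\<theta> i) + poly q (\<theta> i)"
    if "i \<le> d" for i
  proof -
    have "(\<Sum>j\<le>d. entry i j * poly (tail_poly d) (\<theta> j)) = (\<Sum>j\<in>{0}. entry i j * poly (tail_poly d) (\<theta> j))"
      using root by (intro sum.mono_neutral_right) auto
    thus ?thesis using As_poly_vec_entries[OF q(2) that] by simp
  qed
  have "q = smult c (tail_poly (d - 1))"
  proof (rule poly_eqI_degree)
    show "poly q y = poly (smult c (tail_poly (d - 1))) y" if y: "y \<in> \<theta> ` ({..d} - {1})" for y
    proof -
      obtain i where i: "y = \<theta> i" "i \<le> d" "i \<noteq> 1" using y by auto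
      show ?thesis
      proof (cases "i = 0")
        case True
        have "poly q (\<theta> 0) = (x - \<theta>s d) * poly (tail_poly d) (\<theta> 0)"
          using row[of 0] by (simp add: e00 algebra_simps)
        thus ?thesis using True i by (simp add: r0 c_def)
      next
        case False
        hence "2 \<le> i" using i by simp
        thus ?thesis using row[of i] M.tridiagonal[of i 0] i root[of i] root'[of i] by simp
      qed
    qed
    have card: "card (\<theta> ` ({..d} - {1})) = d"
      using X.inj d_pos by (subst card_image) (auto intro: inj_on_subset)
    have "degree q \<le> d - 1" using q(1) by (intro degree_le) auto
    thus "degree q < card (\<theta> ` ({..d} - {1}))" using card d_pos by simp
    show "degree (smult c (tail_poly (d - 1))) < card (\<theta> ` ({..d} - {1}))"
      using card d_pos deg[of "d - 1"] by (auto intro: le_less_trans[OF degree_smult_le])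
  qed
  hence As: "act As (poly_vec (tail_poly d)) = scaleV (\<theta>s d) (poly_vec (tail_poly d)) + scaleV c (poly_vec (tail_poly (d - 1)))"
    using q(2) by (simp add: poly_vec_smult)
  have "scaleV (\<theta>s 0) (act (Es 0) (poly_vec (tail_poly d))) = act (Es 0) (act As (poly_vec (tail_poly d)))"
    using Y.act_E_A[of 0 "poly_vec (tail_poly d)"] by simp
  hence "scaleV (\<theta>s 0 * m) v = scaleV (\<theta>s d * m + c * m') v"
    by (simp add: As act_add_right act_scale_right m m'[unfolded One_nat_def] V.scale_left_distrib)
  hence eq: "\<theta>s 0 * m = \<theta>s d * m + c * m'" using v_ne by simp
  thus "(\<theta>s 0 - \<theta>s d) * m = (\<theta> 0 - \<theta> 1) * (x - \<theta>s d) * m'"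
    by (simp add: c_def algebra_simps)
  have "poly_vec (tail_poly d) = scaleV (poly (tail_poly d) (\<theta> 0)) (act (E 0) v)"
  proof (rule X.eq_by_components)
    show "act (E i) (poly_vec (tail_poly d)) = act (E i) (scaleV (poly (tail_poly d) (\<theta> 0)) (act (E 0) v))"
      if "i \<le> d" for i
      using that root[of i] by (cases "i = 0") (auto simp: poly_vec_component act_scale_right X.act_E_E)
  qed
  moreover have "act (Es 0) (act (E 0) v) \<noteq> 0"
    using eigenvector_first_component[OF E_v_ne[of 0] X.act_A_E[of 0]] by simp
  ultimately have "m \<noteq> 0" using m r00 by (auto simp: act_scale_right)
  moreover have "\<theta>s 0 \<noteq> \<theta>s d" using Y.\<theta>_eq_iff[of 0 d] d_pos by simp
  ultimately show "m' \<noteq> 0" using eq by auto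
qed

end

section \<open>Leonard systems as frames\<close>

text \<open>On eigenvectors \<open>x k\<close> the product defining \<open>E i\<close> evaluates to \<open>1\<close> or \<open>0\<close>, as in Lagrange
interpolation.  This makes the \<open>d + 1\<close> eigenvectors independent, hence a basis of \<open>V\<close>, and by
faithfulness every identity between the idempotents may be checked on it.\<close>
lemma eigen_frame_of_eigen_ordering:
  assumes "faithful_module scaleA scaleV act" and dim: "ordered_basis scaleV d b"
    and ord: "eigen_ordering scaleA scaleV act d A \<theta> E"
  shows "eigen_frame scaleA scaleV act d A \<theta> E"
proof -
  interpret faithful_module scaleA scaleV act by fact
  have bij: "bij_betw \<theta> {..d} (eigenvalues scaleV act A)"
    and E: "\<And>i. i \<le> d \<Longrightarrow> E i = primitive_idempotent scaleA d A \<theta> i"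
    using ord by (auto simp: eigen_ordering_def)
  have inj: "inj_on \<theta> {..d}" using bij by (simp add: bij_betw_def)
  have "\<forall>i. \<exists>x. i \<le> d \<longrightarrow> x \<noteq> 0 \<and> act A x = scaleV (\<theta> i) x"
    using bij by (auto simp: bij_betw_def eigenvalues_def)
  then obtain x where x_ne: "\<And>i. i \<le> d \<Longrightarrow> x i \<noteq> 0"
    and Ax: "\<And>i. i \<le> d \<Longrightarrow> act A (x i) = scaleV (\<theta> i) (x i)" by metis
  have Ex: "act (E i) (x k) = (if i = k then x k else 0)" if "i \<le> d" "k \<le> d" for i k
  proof -
    have "act (\<Prod>j\<leftarrow>js. scaleA (inverse (\<theta> i - \<theta> j)) (A - scaleA (\<theta> j) 1)) (x k) =
        scaleV (\<Prod>j\<leftarrow>js. inverse (\<theta> i - \<theta> j) * (\<theta> k - \<theta> j)) (x k)" for js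
      by (induction js) (simp_all add: act_simps Ax that V.scale_left_diff_distrib[symmetric] mult_ac)
    hence "act (E i) (x k) = scaleV (\<Prod>j\<leftarrow>filter (\<lambda>j. j \<noteq> i) [0..<d + 1].
        inverse (\<theta> i - \<theta> j) * (\<theta> k - \<theta> j)) (x k)"
      using that by (simp only: E primitive_idempotent_def)
    also have "(\<Prod>j\<leftarrow>filter (\<lambda>j. j \<noteq> i) [0..<d + 1]. inverse (\<theta> i - \<theta> j) * (\<theta> k - \<theta> j)) =
        (if i = k then 1 else 0)"
    proof (cases "i = k")
      case True
      have "(\<Prod>j\<leftarrow>filter (\<lambda>j. j \<noteq> i) [0..<d + 1]. inverse (\<theta> i - \<theta> j) * (\<theta> k - \<theta> j)) =
          (\<Prod>j\<leftarrow>filter (\<lambda>j. j \<noteq> i) [0..<d + 1]. 1)"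
        using inj_on_eq_iff[OF inj, of i] that True
        by (intro arg_cong[of _ _ prod_list] map_cong) (auto simp del: upt_Suc)
      thus ?thesis using True by (simp add: map_replicate_const del: upt_Suc)
    next
      case False
      define F where "F j = inverse (\<theta> i - \<theta> j) * (\<theta> k - \<theta> j)" for j
      have "k \<in> set (filter (\<lambda>j. j \<noteq> i) [0..<d + 1])" using that False by (simp del: upt_Suc)
      moreover have "F k = 0" by (simp add: F_def)
      ultimately have "0 \<in> set (map F (filter (\<lambda>j. j \<noteq> i) [0..<d + 1]))"
        unfolding set_map by (metis imageI)
      hence "prod_list (map F (filter (\<lambda>j. j \<noteq> i) [0..<d + 1])) = 0"
        by (simp only: prod_list_zero_iff)
      thus ?thesis by (simp only: F_def[abs_def] False if_False)
    qed
    finally show ?thesis by simp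
  qed
  have injx: "inj_on x {..d}" and indep: "V.independent (x ` {..d})"
    using independent_of_projections[OF Ex x_ne] by auto
  have span: "V.span (x ` {..d}) = UNIV"
  proof (rule UNIV_eq_I[symmetric], rule ccontr)
    fix u
    assume u: "u \<notin> V.span (x ` {..d})"
    have inj_b: "inj_on b {..d}" using dim unfolding ordered_basis_def by (elim conjE)
    have span_b: "V.span (b ` {..d}) = UNIV" using dim unfolding ordered_basis_def by (elim conjE)
    have "insert u (x ` {..d}) \<subseteq> V.span (b ` {..d})" unfolding span_b by (rule subset_UNIV)
    from V.independent_span_bound[OF _ V.independent_insertI[OF u indep] this]
    have "card (insert u (x ` {..d})) \<le> card (b ` {..d})" by (meson finite_imageI finite_atMost)
    also have "\<dots> = d + 1" unfolding card_image[OF inj_b] by simp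
    finally have "card (insert u (x ` {..d})) \<le> d + 1" .
    moreover have "u \<notin> x ` {..d}" using u V.span_base[of u "x ` {..d}"] by (rule contrapos_nn)
    hence "card (insert u (x ` {..d})) = Suc (card (x ` {..d}))"
      by (intro card_insert_disjoint finite_imageI finite_atMost)
    moreover have "card (x ` {..d}) = d + 1" unfolding card_image[OF injx] by simp
    ultimately show False by linarith
  qed
  have basis: "ordered_basis scaleV d x" using injx indep span by (simp add: ordered_basis_def)
  have eqI: "y = z" if "\<And>k. k \<le> d \<Longrightarrow> act y (x k) = act z (x k)" for y z
  proof (rule faithful)
    fix u
    obtain c where "u = (\<Sum>i\<le>d. scaleV (c i) (x i))" using ordered_basis_span[OF basis] by blast
    thus "act y u = act z u" using that by (simp add: act_sum_right act_scale_right)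
  qed
  show ?thesis
  proof
    show "inj_on \<theta> {..d}" by fact
    show "E i * E j = (if i = j then E i else 0)" if "i \<le> d" "j \<le> d" for i j
      by (rule eqI) (use that in \<open>simp add: act_simps Ex\<close>)
    show "(\<Sum>i\<le>d. E i) = 1"
      by (rule eqI) (simp add: act_simps Ex)
    show "A * E i = scaleA (\<theta> i) (E i)" if "i \<le> d" for i
      by (rule eqI) (use that in \<open>simp add: act_simps Ex Ax\<close>)
    show "E i * A = scaleA (\<theta> i) (E i)" if "i \<le> d" for i
      by (rule eqI) (use that in \<open>simp add: act_simps Ex Ax\<close>)
    show "\<exists>c. act (E i) w' = scaleV c (act (E i) w)" if i: "i \<le> d" and w: "act (E i) w \<noteq> 0" for i w w'
    proof -
      have line: "\<exists>c. act (E i) u = scaleV c (x i)" for u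
      proof -
        obtain c where "u = (\<Sum>k\<le>d. scaleV (c k) (x k))" using ordered_basis_span[OF basis] by blast
        hence "act (E i) u = (\<Sum>k\<le>d. if k = i then scaleV (c i) (x i) else 0)"
          unfolding \<open>u = _\<close> act_sum_right using i
          by (intro sum.cong refl) (auto simp: act_scale_right Ex)
        thus ?thesis using i by auto
      qed
      obtain c where c: "act (E i) w = scaleV c (x i)" using line by blast
      obtain c' where c': "act (E i) w' = scaleV c' (x i)" using line by blast
      have "c \<noteq> 0" using c w by auto
      thus ?thesis by (intro exI[of _ "c' / c"]) (simp add: c c')
    qed
  qed
qed

lemma leonard_frame_of_system:
  assumes "faithful_module scaleA scaleV act" and "ordered_basis scaleV d b" and "1 \<le> d"
    and sys: "leonard_system scaleA scaleV act d A E As Es"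
    and "eigen_ordering scaleA scaleV act d A \<theta> E" and "eigen_ordering scaleA scaleV act d As \<theta>s Es"
  shows "leonard_frame scaleA scaleV act d A \<theta> E As \<theta>s Es"
proof -
  interpret X: eigen_frame scaleA scaleV act d A \<theta> E
    using assms by (intro eigen_frame_of_eigen_ordering)
  interpret Y: eigen_frame scaleA scaleV act d As \<theta>s Es
    using assms by (intro eigen_frame_of_eigen_ordering)
  have *: "(\<bar>int i - int j\<bar> > 1 \<longrightarrow> E i * As * E j = 0 \<and> Es i * A * Es j = 0) \<and>
      (\<bar>int i - int j\<bar> = 1 \<longrightarrow> E i * As * E j \<noteq> 0 \<and> Es i * A * Es j \<noteq> 0)" if "i \<le> d" "j \<le> d" for i j
    using sys that unfolding leonard_system_def by blast
  have far: "\<bar>int i - int j\<bar> > 1" if "i + 1 < j \<or> j + 1 < i" for i j using that by auto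
  have adj: "\<bar>int i - int j\<bar> = 1" if "i = j + 1 \<or> j = i + 1" for i j using that by auto
  show ?thesis
  proof
    show "1 \<le> d" by fact
  next
    fix i j assume "i \<le> d" "j \<le> d" "i + 1 < j \<or> j + 1 < i"
    thus "E i * As * E j = 0" "Es i * A * Es j = 0" using * far by blast+
  next
    fix i j assume "i \<le> d" "j \<le> d" "i = j + 1 \<or> j = i + 1"
    thus "E i * As * E j \<noteq> 0" "Es i * A * Es j \<noteq> 0" using * adj by blast+
  qed
qed

section \<open>Construction of isomorphisms\<close>

context leonard_frame_vector
begin

lemma eq_on_eigenbasis:
  assumes "\<And>i. i \<le> d \<Longrightarrow> act y (act (E i) v) = act z (act (E i) v)" shows "y = z"
proof (rule faithful)
  fix u
  obtain p where "u = poly_vec p" using poly_vec_surj by blast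
  thus "act y u = act z u" using assms by (simp add: poly_vec_def act_sum_right act_scale_right)
qed

lemma As_eigenbasis:
  assumes "j \<le> d" shows "act As (act (E j) v) = (\<Sum>i\<le>d. scaleV (entry i j) (act (E i) v))"
proof -
  have "act As (act (E j) v) = (\<Sum>i\<le>d. act (E i) (act As (act (E j) v)))" by (simp only: X.decompose)
  also have "\<dots> = (\<Sum>i\<le>d. scaleV (entry i j) (act (E i) v))"
    by (intro sum.cong refl) (simp flip: entry add: act_mult)
  finally show ?thesis .
qed

text \<open>The images of the basis vectors can be prescribed one at a time by irreducibility, and the
projections \<open>E k\<close> glue the elements that do so.\<close>
lemma transport:
  assumes "irreducible_module scaleA scaleV act"
  shows "\<exists>s. \<forall>i\<le>d. act s (act (E i) v) = e i"
proof -
  interpret irreducible_module scaleA scaleV act by fact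
  have "\<forall>i. \<exists>x. i \<le> d \<longrightarrow> act x (act (E i) v) = e i" using irreducible_act_surj E_v_ne by blast
  then obtain x where x: "\<And>i. i \<le> d \<Longrightarrow> act (x i) (act (E i) v) = e i" by metis
  have "act (\<Sum>k\<le>d. x k * E k) (act (E i) v) = e i" if "i \<le> d" for i
  proof -
    have "act (\<Sum>k\<le>d. x k * E k) (act (E i) v) = (\<Sum>k\<le>d. if k = i then e i else 0)"
      unfolding act_sum_left using that
      by (intro sum.cong refl) (auto simp: act_mult X.act_E_E act_zero_right x)
    thus ?thesis using that by simp
  qed
  thus ?thesis by blast
qed

end

text \<open>
Both second generators have the same matrix in the eigenbases generated by cyclic vectors.  The
element \<open>s\<close> that carries one eigenbasis to the other is invertible and intertwines the two pairs, and
the isomorphism is conjugation by \<open>s\<close>.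
\<close>
lemma leonard_pair_iso_of_frames:
  assumes irr: "irreducible_module scaleA scaleV act"
    and P: "leonard_frame scaleA scaleV act d A \<theta> E As \<theta>s Es"
    and Q: "leonard_frame scaleA scaleV act d B \<theta> F Bs \<theta>s Fs"
    and x: "E 0 * As * E 0 = scaleA x (E 0)" and x': "F 0 * Bs * F 0 = scaleA x (F 0)"
  shows "leonard_pair_iso scaleA scaleA A As B Bs"
proof -
  interpret P0: leonard_frame scaleA scaleV act d A \<theta> E As \<theta>s Es by fact
  interpret Q0: leonard_frame scaleA scaleV act d B \<theta> F Bs \<theta>s Fs by fact
  obtain v where v: "v \<noteq> 0" "act (Es 0) v = v" using P0.exists_cyclic by blast
  obtain w where w: "w \<noteq> 0" "act (Fs 0) w = w" using Q0.exists_cyclic by blast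
  interpret P: leonard_frame_vector scaleA scaleV act d A \<theta> E As \<theta>s Es v by unfold_locales fact+
  interpret Q: leonard_frame_vector scaleA scaleV act d B \<theta> F Bs \<theta>s Fs w by unfold_locales fact+
  have "P.entry 0 0 = x" using x by (intro P.entry_unique) (auto simp: P0.act_scale)
  moreover have "Q.entry 0 0 = x" using x' by (intro Q.entry_unique) (auto simp: P0.act_scale)
  ultimately have entry: "P.entry i j = Q.entry i j" if "i \<le> d" "j \<le> d" for i j
    using leonard_matrix_unique[OF P.M.leonard_matrix_axioms Q.M.leonard_matrix_axioms _ that] by simp
  obtain s where s: "\<And>i. i \<le> d \<Longrightarrow> act s (act (E i) v) = act (F i) w"
    using P.transport[OF irr, of "\<lambda>i. act (F i) w"] by blast
  obtain t where t: "\<And>i. i \<le> d \<Longrightarrow> act t (act (F i) w) = act (E i) v"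
    using Q.transport[OF irr, of "\<lambda>i. act (E i) v"] by blast
  have ts: "t * s = 1" by (rule P.eq_on_eigenbasis) (simp add: P0.act_simps s t)
  have st: "s * t = 1" by (rule Q.eq_on_eigenbasis) (simp add: P0.act_simps s t)
  have sA: "s * A = B * s"
    by (rule P.eq_on_eigenbasis) (simp add: P0.act_simps s P0.X.act_A_E Q0.X.act_A_E)
  have sAs: "s * As = Bs * s"
    by (rule P.eq_on_eigenbasis)
      (simp add: P0.act_mult s P.As_eigenbasis Q.As_eigenbasis P0.act_sum_right P0.act_scale_right entry)
  define f where "f y = s * y * t" for y
  have "bij f"
  proof (rule bij_betw_byWitness[where f' = "\<lambda>y. t * y * s"])
    show "\<forall>y\<in>UNIV. t * f y * s = y" "\<forall>y\<in>UNIV. f (t * y * s) = y"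
      using ts st by (simp_all add: f_def mult.assoc) (simp_all flip: mult.assoc)
  qed auto
  moreover have "f (y + z) = f y + f z" "f (y * z) = f y * f z" "f (scaleA c y) = scaleA c (f y)" for y z c
  proof -
    show "f (y + z) = f y + f z" by (simp add: f_def distrib_left distrib_right)
    show "f (scaleA c y) = scaleA c (f y)"
      by (simp add: f_def P0.scale_mult_left P0.scale_mult_right)
    have "f y * f z = s * y * (t * s) * z * t" by (simp add: f_def mult.assoc)
    thus "f (y * z) = f y * f z" by (simp add: ts f_def mult.assoc)
  qed
  moreover have "f 1 = 1" "f A = B" "f As = Bs"
    by (simp_all add: f_def st sA sAs) (simp_all add: mult.assoc st)
  ultimately show ?thesis unfolding leonard_pair_iso_def algebra_iso_def by blast
qed

section \<open>Split sequences\<close>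

context leonard_frame_vector
begin

text \<open>In an eigenbasis of \<open>As\<close> that starts with \<open>v\<close>, the matrix of \<open>Es 0 * y\<close> is zero outside its
first row.\<close>
lemma trace_first_idempotent:
  assumes t: "act (Es 0 * y) v = scaleV t v"
  shows "algebra_trace scaleV act d (Es 0 * y) = t"
proof -
  define w where "w k = act (Es k) (poly_vec (monom 1 k))" for k
  have w_ne: "w k \<noteq> 0" if "k \<le> d" for k
    using poly_vec_top[of "monom 1 k"] that by (simp add: w_def degree_monom_eq monom_eq_0_iff)
  have w0: "w 0 = v"
    by (simp add: w_def monom_0 poly_vec_const Es_v act_scale_right)
  have proj: "act (Es i) (w k) = (if i = k then w k else 0)" if "i \<le> d" "k \<le> d" for i k
    using that by (simp add: w_def Y.act_E_E)
  have "V.span (w ` {..d}) = UNIV"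
  proof -
    have "u \<in> V.span (w ` {..d})" for u
    proof -
      have "act (Es k) u \<in> V.span (w ` {..d})" if k: "k \<le> d" for k
      proof -
        have "act (Es k) (w k) \<noteq> 0" using w_ne[OF k] proj[OF k k] by simp
        from Y.rank_one[OF k this] obtain c where "act (Es k) u = scaleV c (act (Es k) (w k))" by blast
        thus ?thesis using k proj[OF k k] by (auto intro: V.span_scale V.span_base)
      qed
      hence "(\<Sum>k\<le>d. act (Es k) u) \<in> V.span (w ` {..d})" by (intro V.span_sum) auto
      thus ?thesis by (simp only: Y.decompose)
    qed
    thus ?thesis by blast
  qed
  hence basis: "ordered_basis scaleV d w"
    using independent_of_projections[OF proj w_ne] by (simp add: ordered_basis_def)
  have "act (Es 0) v \<noteq> 0" using v_ne Es_v by simp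
  hence "\<forall>j. \<exists>c. act (Es 0 * y) (w j) = scaleV c v"
    using Y.rank_one[of 0 v] Es_v by (simp add: act_mult)
  from choice[OF this] obtain c where c: "\<And>j. act (Es 0 * y) (w j) = scaleV (c j) v" by blast
  define Y where "Y = mat (d + 1) (d + 1) (\<lambda>(i, j). if i = 0 then c j else 0)"
  have "represents scaleV act d w Y (Es 0 * y)"
    unfolding represents_def
  proof (intro conjI allI impI)
    fix j assume j: "j \<le> d"
    have "(\<Sum>i\<le>d. scaleV (Y $$ (i, j)) (w i)) = (\<Sum>i\<le>d. if i = 0 then scaleV (c j) v else 0)"
      using j by (intro sum.cong refl) (auto simp: Y_def w0)
    thus "act (Es 0 * y) (w j) = (\<Sum>i\<le>d. scaleV (Y $$ (i, j)) (w i))" by (simp add: c)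
  qed (simp add: Y_def)
  hence "algebra_trace scaleV act d (Es 0 * y) = (\<Sum>i\<le>d. Y $$ (i, i))"
    by (rule algebra_trace_eq[OF basis])
  also have "\<dots> = (\<Sum>i\<le>d. if i = 0 then c 0 else 0)"
    by (intro sum.cong refl) (auto simp: Y_def)
  also have "\<dots> = t" using c[of 0] t v_ne by (simp add: w0)
  finally show ?thesis .
qed

lemma shifted_prod_v:
  "act (shifted_prod scaleA A \<tau> n) v = poly_vec (\<Prod>h<n. [:- \<tau> h, 1:])"
proof (rule X.eq_by_components)
  fix k assume k: "k \<le> d"
  have "act (E k) (act (shifted_prod scaleA A \<tau> n) u) =
      scaleV (\<Prod>h<n. \<theta> k - \<tau> h) (act (E k) u)" for u
    using k
    by (induction n arbitrary: u)
      (simp_all add: shifted_prod_def act_simps X.act_E_A mult_ac left_diff_distrib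
        flip: V.scale_left_diff_distrib)
  thus "act (E k) (act (shifted_prod scaleA A \<tau> n) v) = act (E k) (poly_vec (\<Prod>h<n. [:- \<tau> h, 1:]))"
    using k by (simp add: poly_vec_component poly_prod)
qed

lemma trace_shifted_prod:
  "act (Es 0) (poly_vec (\<Prod>h<n. [:- \<tau> h, 1:])) =
    scaleV (algebra_trace scaleV act d (Es 0 * shifted_prod scaleA A \<tau> n)) v"
proof -
  have "act (Es 0) v \<noteq> 0" using v_ne Es_v by simp
  then obtain m where m: "act (Es 0 * shifted_prod scaleA A \<tau> n) v = scaleV m v"
    using Y.rank_one[of 0 v] Es_v by (auto simp: act_mult)
  thus ?thesis
    using trace_first_idempotent[OF m] by (simp add: act_mult shifted_prod_v)
qed

end

context leonard_frame
begin

lemma E_ne: assumes "i \<le> d" shows "E i \<noteq> 0"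
proof -
  obtain v where v: "v \<noteq> 0" "act (Es 0) v = v" using exists_cyclic by blast
  interpret W: leonard_frame_vector scaleA scaleV act d A \<theta> E As \<theta>s Es v by unfold_locales fact+
  show ?thesis using W.E_v_ne[OF assms] by (auto simp: act_zero_left)
qed

lemma split_start:
  assumes a: "Es 0 * A * Es 0 = scaleA a (Es 0)"
  shows "algebra_trace scaleV act d (Es 0 * shifted_prod scaleA A \<tau> 1) /
    algebra_trace scaleV act d (Es 0 * shifted_prod scaleA A \<tau> 0) = a - \<tau> 0"
proof -
  obtain v where v: "v \<noteq> 0" "act (Es 0) v = v" using exists_cyclic by blast
  interpret W: leonard_frame_vector scaleA scaleV act d A \<theta> E As \<theta>s Es v by unfold_locales fact+
  have "act (Es 0) (act A v) = scaleV a v"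
    using arg_cong[OF a, of "\<lambda>z. act z v"] by (simp add: act_mult act_scale v)
  hence "algebra_trace scaleV act d (Es 0 * shifted_prod scaleA A \<tau> 1) = a - \<tau> 0"
    by (intro W.trace_first_idempotent)
      (simp add: shifted_prod_def act_simps v V.scale_left_diff_distrib)
  moreover have "algebra_trace scaleV act d (Es 0 * shifted_prod scaleA A \<tau> 0) = 1"
    by (intro W.trace_first_idempotent) (simp add: shifted_prod_def v)
  ultimately show ?thesis by simp
qed

lemma split_end:
  assumes x: "E 0 * As * E 0 = scaleA x (E 0)"
    and \<tau>: "\<And>h. h < d \<Longrightarrow> \<tau> h = \<theta> (d - h)"
  shows "(\<theta>s 0 - \<theta>s d) * (algebra_trace scaleV act d (Es 0 * shifted_prod scaleA A \<tau> d) /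
    algebra_trace scaleV act d (Es 0 * shifted_prod scaleA A \<tau> (d - 1))) =
    (\<theta> 0 - \<theta> 1) * (x - \<theta>s d)"
proof -
  obtain v where v: "v \<noteq> 0" "act (Es 0) v = v" using exists_cyclic by blast
  interpret W: leonard_frame_vector scaleA scaleV act d A \<theta> E As \<theta>s Es v by unfold_locales fact+
  define m where "m n = algebra_trace scaleV act d (Es 0 * shifted_prod scaleA A \<tau> n)" for n
  have "act (Es 0) (W.poly_vec (W.tail_poly n)) = scaleV (m n) v" if "n \<le> d" for n
  proof -
    have "W.tail_poly n = (\<Prod>h<n. [:- \<tau> h, 1:])"
      unfolding W.tail_poly_def using \<tau> that by (intro prod.cong) auto
    thus ?thesis by (simp add: W.trace_shifted_prod m_def)
  qed
  from W.last_second_split_coefficient[OF x this[of d] this[of "d - 1"]]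
  have "(\<theta>s 0 - \<theta>s d) * m d = (\<theta> 0 - \<theta> 1) * (x - \<theta>s d) * m (d - 1)" "m (d - 1) \<noteq> 0" by auto
  thus ?thesis by (simp add: m_def[symmetric] divide_eq_eq)
qed

lemma corner_relation:
  assumes "E 0 * As * E 0 = scaleA x (E 0)" and "Es 0 * A * Es 0 = scaleA a (Es 0)"
  shows "(\<theta> 0 - \<theta> 1) * (x - \<theta>s 0) = (\<theta>s 0 - \<theta>s 1) * (a - \<theta> 0)"
proof -
  obtain v where v: "v \<noteq> 0" "act (Es 0) v = v" using exists_cyclic by blast
  interpret W: leonard_frame_vector scaleA scaleV act d A \<theta> E As \<theta>s Es v by unfold_locales fact+
  show ?thesis using W.corner_relation_cyclic assms by blast
qed

lemma eigenvalues_symmetric: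
  assumes "\<theta> 1 + \<theta> (d - 1) = \<theta> 0 + \<theta> d" and "i \<le> d"
  shows "\<theta> i = - \<theta> (d - i) + (\<theta> 0 + \<theta> d)"
proof -
  obtain v where v: "v \<noteq> 0" "act (Es 0) v = v" using exists_cyclic by blast
  interpret W: leonard_frame_vector scaleA scaleV act d A \<theta> E As \<theta>s Es v by unfold_locales fact+
  show ?thesis using W.M.spectrum_symmetric[OF assms] by (simp add: algebra_simps)
qed

lemma reverse_first: "leonard_frame scaleA scaleV act d A (\<lambda>i. \<theta> (d - i)) (\<lambda>i. E (d - i)) As \<theta>s Es"
  by (rule leonard_frame.dual[OF leonard_frame.reverse[OF dual]])

lemma diagonal_affine:
  assumes "i \<le> d" "E i * As * E i = scaleA x (E i)"
  shows "E i * (scaleA \<xi> As + scaleA \<zeta> 1) * E i = scaleA (\<xi> * x + \<zeta>) (E i)"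
  using assms
  by (simp add: distrib_left distrib_right scale_mult_left scale_mult_right X.E_E scale_left_distrib)

end

section \<open>Action of an isomorphism on the idempotents\<close>

text \<open>An injective walk on a path cannot turn back, so its direction is constant.\<close>
lemma path_automorphism:
  fixes \<pi> :: "nat \<Rightarrow> nat"
  assumes inj: "inj_on \<pi> {..d}" and range: "\<And>i. i \<le> d \<Longrightarrow> \<pi> i \<le> d"
    and adj: "\<And>i. i < d \<Longrightarrow> \<pi> (Suc i) = \<pi> i + 1 \<or> \<pi> i = \<pi> (Suc i) + 1"
  shows "(\<forall>i\<le>d. \<pi> i = i) \<or> (\<forall>i\<le>d. \<pi> i = d - i)"
proof (cases "d = 0")
  case True
  moreover have "\<pi> 0 = 0" using range[of 0] True by simp
  ultimately show ?thesis by simp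
next
  case False
  have ne: "\<pi> (Suc (Suc i)) \<noteq> \<pi> i" if "Suc (Suc i) \<le> d" for i
    using inj_on_eq_iff[OF inj, of "Suc (Suc i)" i] that by simp
  show ?thesis
  proof (cases "\<pi> 1 = \<pi> 0 + 1")
    case up: True
    have run: "\<pi> i = \<pi> 0 + i \<and> (i < d \<longrightarrow> \<pi> (Suc i) = \<pi> i + 1)" if "i \<le> d" for i
      using that
    proof (induction i)
      case (Suc i)
      have "\<pi> (Suc i) = \<pi> i + 1" "\<pi> i = \<pi> 0 + i" using Suc by simp_all
      moreover have "\<pi> (Suc (Suc i)) = \<pi> (Suc i) + 1" if "Suc i < d"
        using adj[OF that] ne[OF Suc_leI[OF that]] \<open>\<pi> (Suc i) = \<pi> i + 1\<close> by linarith
      ultimately show ?case by simp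
    qed (use up in simp)
    have "\<pi> 0 = 0" using run[of d] range[of d] by linarith
    hence "\<pi> i = i" if "i \<le> d" for i using run[OF that] by linarith
    thus ?thesis by blast
  next
    case down: False
    hence first: "\<pi> 0 = \<pi> 1 + 1" using adj[of 0] False by simp
    have run: "\<pi> 0 = \<pi> i + i \<and> (i < d \<longrightarrow> \<pi> i = \<pi> (Suc i) + 1)" if "i \<le> d" for i
      using that
    proof (induction i)
      case (Suc i)
      have "\<pi> i = \<pi> (Suc i) + 1" "\<pi> 0 = \<pi> i + i" using Suc by simp_all
      moreover have "\<pi> (Suc i) = \<pi> (Suc (Suc i)) + 1" if "Suc i < d"
        using adj[OF that] ne[OF Suc_leI[OF that]] \<open>\<pi> i = \<pi> (Suc i) + 1\<close> by linarith
      ultimately show ?case by simp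
    qed (use first in simp)
    have "\<pi> 0 = d" using run[of d] range[of 0] by linarith
    hence "\<pi> i = d - i" if "i \<le> d" for i using run[OF that] by linarith
    thus ?thesis by blast
  qed
qed

text \<open>
If \<open>E k * f (E i) \<noteq> 0\<close>, then evaluating \<open>E k * f A * f (E i)\<close> from both sides gives
\<open>\<theta> i = \<xi> * \<theta> k + \<zeta>\<close>, which determines \<open>k\<close>; call it \<open>\<pi> i\<close>.  Expanding \<open>1\<close> as the sum of the
\<open>E k\<close> on the left and as the sum of the \<open>f (E j)\<close> on the right shows that \<open>f (E i)\<close> and
\<open>E (\<pi> i)\<close> both equal \<open>E (\<pi> i) * f (E i)\<close>.
\<close>
lemma (in eigen_frame) iso_permutes_idempotents:
  assumes f: "algebra_iso scaleA scaleA f" and fA: "f A = scaleA \<xi> A + scaleA \<zeta> 1" and \<xi>: "\<xi> \<noteq> 0"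
    and ne: "\<And>i. i \<le> d \<Longrightarrow> E i \<noteq> 0"
  shows "\<exists>\<pi>. inj_on \<pi> {..d} \<and> (\<forall>i\<le>d. \<pi> i \<le> d \<and> f (E i) = E (\<pi> i) \<and> \<theta> i = \<xi> * \<theta> (\<pi> i) + \<zeta>)"
proof -
  have add: "f (x + y) = f x + f y" and mult: "f (x * y) = f x * f y" and one: "f 1 = 1"
    and sc: "f (scaleA c x) = scaleA c (f x)" and inj_f: "inj f" for x y c
    using f by (auto simp: algebra_iso_def bij_def)
  have f0: "f 0 = 0" using add[of 0 0] by simp
  have f_sum: "f (sum g I) = (\<Sum>i\<in>I. f (g i))" for g :: "nat \<Rightarrow> 'a" and I
    by (induction I rule: infinite_finite_induct) (simp_all add: f0 add)
  have eig: "\<theta> i = \<xi> * \<theta> k + \<zeta>" if "i \<le> d" "k \<le> d" "E k * f (E i) \<noteq> 0" for i k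
  proof -
    have "scaleA (\<theta> i) (E k * f (E i)) = E k * f (A * E i)"
      using that by (simp add: A_E sc scale_mult_right)
    also have "\<dots> = scaleA (\<xi> * \<theta> k + \<zeta>) (E k * f (E i))"
      using that by (simp add: mult fA distrib_left distrib_right scale_mult_left scale_mult_right
          E_A scale_left_distrib flip: mult.assoc)
    finally show ?thesis using that by simp
  qed
  have "\<forall>i. \<exists>k. i \<le> d \<longrightarrow> k \<le> d \<and> E k * f (E i) \<noteq> 0"
  proof (intro allI)
    fix i
    show "\<exists>k. i \<le> d \<longrightarrow> k \<le> d \<and> E k * f (E i) \<noteq> 0"
    proof (rule ccontr)
      assume "\<not> ?thesis"
      hence i: "i \<le> d" and z: "\<And>k. k \<le> d \<Longrightarrow> E k * f (E i) = 0" by auto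
      have "f (E i) = (\<Sum>k\<le>d. E k) * f (E i)" by (simp add: E_sum)
      also have "\<dots> = 0" by (simp add: sum_distrib_right z)
      finally show False using inj_f ne[OF i] f0 by (metis injD)
    qed
  qed
  from choice[OF this] obtain \<pi> where \<pi>: "\<And>i. i \<le> d \<Longrightarrow> \<pi> i \<le> d \<and> E (\<pi> i) * f (E i) \<noteq> 0" by blast
  have \<theta>\<pi>: "\<theta> i = \<xi> * \<theta> (\<pi> i) + \<zeta>" if "i \<le> d" for i using eig \<pi> that by blast
  have off: "E k * f (E i) = 0" if "i \<le> d" "k \<le> d" "k \<noteq> \<pi> i" for i k
  proof (rule ccontr)
    assume "E k * f (E i) \<noteq> 0"
    hence "\<xi> * \<theta> k + \<zeta> = \<xi> * \<theta> (\<pi> i) + \<zeta>" using eig \<theta>\<pi> that by metis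
    thus False using \<xi> \<theta>_eq_iff[of k "\<pi> i"] \<pi>[of i] that by simp
  qed
  have inj\<pi>: "inj_on \<pi> {..d}"
  proof (rule inj_onI)
    fix i j assume "i \<in> {..d}" "j \<in> {..d}" "\<pi> i = \<pi> j"
    thus "i = j" using \<theta>\<pi>[of i] \<theta>\<pi>[of j] \<theta>_eq_iff[of i j] by simp
  qed
  have "f (E i) = E (\<pi> i)" if i: "i \<le> d" for i
  proof -
    have k: "\<pi> i \<le> d" using \<pi> i by blast
    have "f (E i) = (\<Sum>k\<le>d. E k * f (E i))" by (simp add: E_sum flip: sum_distrib_right)
    also have "\<dots> = (\<Sum>k\<in>{\<pi> i}. E k * f (E i))"
      using k off[OF i] by (intro sum.mono_neutral_right) auto
    finally have 1: "f (E i) = E (\<pi> i) * f (E i)" by simp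
    have "E (\<pi> i) = E (\<pi> i) * f (\<Sum>j\<le>d. E j)" by (simp add: E_sum one)
    also have "\<dots> = (\<Sum>j\<le>d. E (\<pi> i) * f (E j))" by (simp add: f_sum sum_distrib_left)
    also have "\<dots> = (\<Sum>j\<in>{i}. E (\<pi> i) * f (E j))"
      using i k off[of _ "\<pi> i"] inj_on_eq_iff[OF inj\<pi>, of i] by (intro sum.mono_neutral_right) auto
    finally show ?thesis using 1 by simp
  qed
  thus ?thesis using inj\<pi> \<pi> \<theta>\<pi> by blast
qed

context leonard_frame
begin

text \<open>
The two alternatives are the identity and the reversal of the \<open>E i\<close>.  The equations between \<open>x\<close> and
\<open>y\<close> come from applying \<open>f\<close> to \<open>E 0 * As * E 0 = x E 0\<close> and \<open>E d * As * E d = y E d\<close>, and the last equation of the second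
alternative is the eigenvalue comparison at index \<open>1\<close>.
\<close>
lemma iso_first_cases:
  assumes f: "algebra_iso scaleA scaleA f" and fA: "f A = scaleA \<xi> A + scaleA \<zeta> 1"
    and fAs: "f As = scaleA \<xi>s As + scaleA \<zeta>s 1" and \<xi>: "\<xi> \<noteq> 0" and \<xi>s: "\<xi>s \<noteq> 0"
    and x: "E 0 * As * E 0 = scaleA x (E 0)" and y: "E d * As * E d = scaleA y (E d)"
  shows "\<xi> = 1 \<and> \<zeta> = 0 \<and> x = \<xi>s * x + \<zeta>s \<and> y = \<xi>s * y + \<zeta>s \<or>
    \<xi> = -1 \<and> \<zeta> = \<theta> 0 + \<theta> d \<and> x = \<xi>s * y + \<zeta>s \<and> \<theta> 1 + \<theta> (d - 1) = \<theta> 0 + \<theta> d"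
proof -
  have mult: "f (u * w) = f u * f w" and sc: "f (scaleA c u) = scaleA c (f u)" and inj_f: "inj f"
    and add: "f (u + w) = f u + f w" for u w c
    using f by (auto simp: algebra_iso_def bij_def)
  have f0: "f 0 = 0" using add[of 0 0] by simp
  obtain \<pi> where inj: "inj_on \<pi> {..d}"
    and \<pi>: "\<And>i. i \<le> d \<Longrightarrow> \<pi> i \<le> d" and fE: "\<And>i. i \<le> d \<Longrightarrow> f (E i) = E (\<pi> i)"
    and \<theta>\<pi>: "\<And>i. i \<le> d \<Longrightarrow> \<theta> i = \<xi> * \<theta> (\<pi> i) + \<zeta>"
    using X.iso_permutes_idempotents[OF f fA \<xi> E_ne] by blast
  have "\<pi> (Suc i) = \<pi> i + 1 \<or> \<pi> i = \<pi> (Suc i) + 1" if "i < d" for i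
  proof (rule ccontr)
    assume not: "\<not> ?thesis"
    have ne: "\<pi> i \<noteq> \<pi> (Suc i)" using inj_on_eq_iff[OF inj, of i "Suc i"] that by simp
    have "f (E i * As * E (Suc i)) = scaleA \<xi>s (E (\<pi> i) * As * E (\<pi> (Suc i)))"
      using that ne \<pi> by (simp add: mult fE fAs E_affine_E)
    also have "E (\<pi> i) * As * E (\<pi> (Suc i)) = 0"
    proof (rule E_far)
      show "\<pi> i + 1 < \<pi> (Suc i) \<or> \<pi> (Suc i) + 1 < \<pi> i" using not ne by linarith
    qed (use \<pi> that in simp_all)
    finally have "f (E i * As * E (Suc i)) = 0" by simp
    hence "E i * As * E (Suc i) = 0" using inj_f f0 by (metis injD)
    thus False using E_adj[of i "Suc i"] that by simp
  qed
  from path_automorphism[OF inj \<pi> this]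
  have cases: "(\<forall>i\<le>d. \<pi> i = i) \<or> (\<forall>i\<le>d. \<pi> i = d - i)" by blast
  have diag: "z = \<xi>s * z' + \<zeta>s"
    if "i \<le> d" "E i * As * E i = scaleA z (E i)" "E (\<pi> i) * As * E (\<pi> i) = scaleA z' (E (\<pi> i))" for i z z'
  proof -
    have "scaleA z (E (\<pi> i)) = f (E i * As * E i)" using that by (simp add: sc fE)
    also have "\<dots> = E (\<pi> i) * (scaleA \<xi>s As + scaleA \<zeta>s 1) * E (\<pi> i)"
      by (simp only: mult fE[OF that(1)] fAs)
    also have "\<dots> = scaleA (\<xi>s * z' + \<zeta>s) (E (\<pi> i))"
      by (rule diagonal_affine[OF \<pi>[OF that(1)] that(3)])
    finally show ?thesis using E_ne \<pi> that by auto
  qed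
  have \<theta>_ne: "\<theta> 0 \<noteq> \<theta> d" using X.\<theta>_eq_iff[of 0 d] d_pos by simp
  show ?thesis
    using cases
  proof
    assume id: "\<forall>i\<le>d. \<pi> i = i"
    have 0: "\<theta> 0 = \<xi> * \<theta> 0 + \<zeta>" and d: "\<theta> d = \<xi> * \<theta> d + \<zeta>" using \<theta>\<pi>[of 0] \<theta>\<pi>[of d] id by auto
    have "\<theta> 0 - \<theta> d = (\<xi> * \<theta> 0 + \<zeta>) - (\<xi> * \<theta> d + \<zeta>)" by (rule arg_cong2[OF 0 d])
    also have "\<dots> = \<xi> * (\<theta> 0 - \<theta> d)" by (simp add: right_diff_distrib)
    finally have "\<theta> 0 - \<theta> d = \<xi> * (\<theta> 0 - \<theta> d)" .
    hence "\<xi> = 1" using \<theta>_ne by simp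
    moreover from this have "\<zeta> = 0" using 0 by simp
    ultimately show ?thesis using diag[of 0 x x] diag[of d y y] id x y by simp
  next
    assume rev: "\<forall>i\<le>d. \<pi> i = d - i"
    have 0: "\<theta> 0 = \<xi> * \<theta> d + \<zeta>" and d: "\<theta> d = \<xi> * \<theta> 0 + \<zeta>" using \<theta>\<pi>[of 0] \<theta>\<pi>[of d] rev by auto
    have "\<theta> 0 - \<theta> d = (\<xi> * \<theta> d + \<zeta>) - (\<xi> * \<theta> 0 + \<zeta>)" by (rule arg_cong2[OF 0 d])
    also have "\<dots> = - (\<xi> * (\<theta> 0 - \<theta> d))" by (simp add: right_diff_distrib)
    finally have "(\<xi> + 1) * (\<theta> 0 - \<theta> d) = 0" by (simp add: distrib_right add_eq_0_iff)
    hence "\<xi> = -1" using \<theta>_ne by (simp add: add_eq_0_iff2)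
    moreover from this have "\<zeta> = \<theta> 0 + \<theta> d" using 0 by (simp add: algebra_simps)
    moreover have "\<theta> 1 = \<xi> * \<theta> (d - 1) + \<zeta>" using \<theta>\<pi>[of 1] rev d_pos by simp
    ultimately show ?thesis using diag[of 0 x y] rev x y by simp
  qed
qed

end

section \<open>Affine images of a Leonard pair\<close>

context leonard_frame
begin
text \<open>Reversing the \<open>Es i\<close> and reflecting \<open>As\<close> cancel in their effect on a symmetric sequence of
eigenvalues.\<close>
lemma reflect_second:
  assumes "\<theta>s 1 + \<theta>s (d - 1) = \<theta>s 0 + \<theta>s d"
  shows "leonard_frame scaleA scaleV act d A \<theta> E
    (scaleA (-1) As + scaleA (\<theta>s 0 + \<theta>s d) 1) \<theta>s (\<lambda>i. Es (d - i))"
proof (rule leonard_frame.affine[OF reverse])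
  show "\<theta>s i = -1 * \<theta>s (d - i) + (\<theta>s 0 + \<theta>s d)" if "i \<le> d" for i
    using leonard_frame.eigenvalues_symmetric[OF dual assms that] by simp
qed simp

lemma reflect_first:
  assumes "\<theta> 1 + \<theta> (d - 1) = \<theta> 0 + \<theta> d"
  shows "leonard_frame scaleA scaleV act d (scaleA (-1) A + scaleA (\<theta> 0 + \<theta> d) 1)
    \<theta> (\<lambda>i. E (d - i)) As \<theta>s Es"
  by (rule leonard_frame.dual[OF leonard_frame.reflect_second[OF dual assms]])

end

lemma exactly_one_alternative:
  assumes "P \<Longrightarrow> Q1 \<or> Q2 \<or> Q3 \<or> Q4" and "Q1 \<Longrightarrow> P" and "Q2 \<Longrightarrow> P" and "Q3 \<Longrightarrow> P" and "Q4 \<Longrightarrow> P"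
    and "\<not> (Q1 \<and> Q2)" and "\<not> (Q1 \<and> Q3)" and "\<not> (Q1 \<and> Q4)"
    and "\<not> (Q2 \<and> Q3)" and "\<not> (Q2 \<and> Q4)" and "\<not> (Q3 \<and> Q4)"
  shows "(P \<longleftrightarrow> Q1 \<or> Q2 \<or> Q3 \<or> Q4) \<and>
    (P \<longrightarrow>
      (Q1 \<and> \<not> Q2 \<and> \<not> Q3 \<and> \<not> Q4) \<or> (\<not> Q1 \<and> Q2 \<and> \<not> Q3 \<and> \<not> Q4) \<or>
      (\<not> Q1 \<and> \<not> Q2 \<and> Q3 \<and> \<not> Q4) \<or> (\<not> Q1 \<and> \<not> Q2 \<and> \<not> Q3 \<and> Q4))"
  using assms by blast

theorem proposition11p2:
  fixes scaleA :: "'k::field \<Rightarrow> 'a::ring_1 \<Rightarrow> 'a"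
    and scaleV :: "'k \<Rightarrow> 'v::ab_group_add \<Rightarrow> 'v"
    and act :: "'a \<Rightarrow> 'v \<Rightarrow> 'v"
    and d :: nat
    and A As :: 'a
    and E Es :: "nat \<Rightarrow> 'a"
    and \<theta> \<theta>s \<phi>1 \<phi>2 :: "nat \<Rightarrow> 'k"
    and \<xi> \<zeta> \<xi>s \<zeta>s :: 'k
  assumes "matrix_algebra scaleA d"
    and "irreducible_module scaleA scaleV act"
    and "leonard_pair scaleV act d A As"
    and "leonard_system scaleA scaleV act d A E As Es"
    and "parameter_array scaleA scaleV act d A E As Es \<theta> \<theta>s \<phi>1 \<phi>2"
    and "d \<ge> 1"
    and "\<xi> \<noteq> 0" and "\<xi>s \<noteq> 0"
  shows "let
      iso = leonard_pair_iso scaleA scaleA A As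
              (scaleA \<xi> A + scaleA \<zeta> 1) (scaleA \<xi>s As + scaleA \<zeta>s 1);
      c1 = (\<xi> = 1 \<and> \<zeta> = 0 \<and> \<xi>s = 1 \<and> \<zeta>s = 0);
      c2 = (\<phi>1 1 = - \<phi>2 d \<and> \<phi>1 d = - \<phi>2 1 \<and>
            \<xi> = 1 \<and> \<zeta> = 0 \<and> \<xi>s = -1 \<and> \<zeta>s = \<theta>s 0 + \<theta>s d);
      c3 = (\<phi>1 1 = - \<phi>2 1 \<and> \<phi>1 d = - \<phi>2 d \<and>
            \<xi> = -1 \<and> \<zeta> = \<theta> 0 + \<theta> d \<and> \<xi>s = 1 \<and> \<zeta>s = 0);
      c4 = (\<phi>1 1 = \<phi>1 d \<and> \<phi>2 1 = \<phi>2 d \<and>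
            \<xi> = -1 \<and> \<zeta> = \<theta> 0 + \<theta> d \<and> \<xi>s = -1 \<and> \<zeta>s = \<theta>s 0 + \<theta>s d)
    in (iso \<longleftrightarrow> c1 \<or> c2 \<or> c3 \<or> c4) \<and>
       (iso \<longrightarrow>
          (c1 \<and> \<not> c2 \<and> \<not> c3 \<and> \<not> c4) \<or> (\<not> c1 \<and> c2 \<and> \<not> c3 \<and> \<not> c4) \<or>
          (\<not> c1 \<and> \<not> c2 \<and> c3 \<and> \<not> c4) \<or> (\<not> c1 \<and> \<not> c2 \<and> \<not> c3 \<and> c4))"
proof -
  note irr = \<open>irreducible_module scaleA scaleV act\<close>
  have faithful: "faithful_module scaleA scaleV act"
    using assms(1) irr by (rule faithful_of_matrix_algebra)
  obtain b where basis: "ordered_basis scaleV d b"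
    using assms(3) unfolding leonard_pair_def by (elim conjE exE)
  let ?tr = "algebra_trace scaleV act d"
  have ord: "eigen_ordering scaleA scaleV act d A \<theta> E" and ords: "eigen_ordering scaleA scaleV act d As \<theta>s Es"
    using assms(5) unfolding parameter_array_def Let_def by blast+
  have \<phi>1: "\<phi>1 i = (\<theta>s 0 - \<theta>s i) *
      (?tr (Es 0 * shifted_prod scaleA A \<theta> i) / ?tr (Es 0 * shifted_prod scaleA A \<theta> (i - 1)))"
    if "i \<in> {1..d}" for i
    using assms(5) that unfolding parameter_array_def Let_def by blast
  have \<phi>2: "\<phi>2 i = (\<theta>s 0 - \<theta>s i) *
      (?tr (Es 0 * shifted_prod scaleA A (\<lambda>h. \<theta> (d - h)) i) /
       ?tr (Es 0 * shifted_prod scaleA A (\<lambda>h. \<theta> (d - h)) (i - 1)))"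
    if "i \<in> {1..d}" for i
    using assms(5) that unfolding parameter_array_def Let_def by blast
  have frame: "leonard_frame scaleA scaleV act d A \<theta> E As \<theta>s Es"
    by (rule leonard_frame_of_system[OF faithful basis \<open>1 \<le> d\<close> assms(4) ord ords])
  interpret L: leonard_frame scaleA scaleV act d A \<theta> E As \<theta>s Es by (rule frame)
  have revE: "leonard_frame scaleA scaleV act d A (\<lambda>i. \<theta> (d - i)) (\<lambda>i. E (d - i)) As \<theta>s Es"
    by (rule L.reverse_first)
  have revEs: "leonard_frame scaleA scaleV act d A \<theta> E As (\<lambda>i. \<theta>s (d - i)) (\<lambda>i. Es (d - i))"
    by (rule L.reverse)
  have revEEs: "leonard_frame scaleA scaleV act d A (\<lambda>i. \<theta> (d - i)) (\<lambda>i. E (d - i)) As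
      (\<lambda>i. \<theta>s (d - i)) (\<lambda>i. Es (d - i))"
    by (rule leonard_frame.reverse[OF revE])
  obtain x where x: "E 0 * As * E 0 = scaleA x (E 0)" using L.X.corner_scalar[of 0] by auto
  obtain y where y: "E d * As * E d = scaleA y (E d)" using L.X.corner_scalar[of d] by auto
  obtain a where a: "Es 0 * A * Es 0 = scaleA a (Es 0)" using L.Y.corner_scalar[of 0] by auto
  obtain c where c: "Es d * A * Es d = scaleA c (Es d)" using L.Y.corner_scalar[of d] by auto
  have y': "E (d - 0) * As * E (d - 0) = scaleA y (E (d - 0))" using y by simp
  have c': "Es (d - 0) * A * Es (d - 0) = scaleA c (Es (d - 0))" using c by simp
  (* F1 - F4 express the four end terms by the corner scalars of As, G1 - G4 by those of A.  Two of
     each kind hold by the definition of the split sequences and by split_end; the corner relation of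
     the appropriate reversed system converts between the two kinds. *)
  define p where "p = \<theta> 0 - \<theta> 1"
  define q where "q = \<theta> d - \<theta> (d - 1)"
  define ps where "ps = \<theta>s 0 - \<theta>s 1"
  define qs where "qs = \<theta>s d - \<theta>s (d - 1)"
  have G1: "\<phi>1 1 = ps * (a - \<theta> 0)"
    using \<phi>1[of 1] L.split_start[OF a, of \<theta>] \<open>1 \<le> d\<close> by (simp add: ps_def del: times_divide_eq_right)
  have G3: "\<phi>2 1 = ps * (a - \<theta> d)"
    using \<phi>2[of 1] L.split_start[OF a, of "\<lambda>h. \<theta> (d - h)"] \<open>1 \<le> d\<close> by (simp add: ps_def del: times_divide_eq_right)
  have F2: "\<phi>2 d = p * (x - \<theta>s d)"
    using \<phi>2[of d] L.split_end[OF x, of "\<lambda>h. \<theta> (d - h)"] \<open>1 \<le> d\<close> by (simp add: p_def del: times_divide_eq_right)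
  have F4: "\<phi>1 d = q * (y - \<theta>s d)"
    using \<phi>1[of d] leonard_frame.split_end[OF revE y', of \<theta>] \<open>1 \<le> d\<close> by (simp add: q_def del: times_divide_eq_right)
  have F1: "\<phi>1 1 = p * (x - \<theta>s 0)"
    using L.corner_relation[OF x a] unfolding G1 p_def ps_def by simp
  have F3: "\<phi>2 1 = q * (y - \<theta>s 0)"
    using leonard_frame.corner_relation[OF revE y' a] unfolding G3 q_def ps_def by simp
  have G2: "\<phi>2 d = qs * (c - \<theta> 0)"
    using leonard_frame.corner_relation[OF revEs x c'] unfolding F2 p_def qs_def by simp
  have G4: "\<phi>1 d = qs * (c - \<theta> d)"
    using leonard_frame.corner_relation[OF revEEs y' c'] unfolding F4 q_def qs_def by simp
  have ne: "\<theta> 0 \<noteq> \<theta> d" "\<theta>s 0 \<noteq> \<theta>s d"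
    using L.X.\<theta>_eq_iff[of 0 d] L.Y.\<theta>_eq_iff[of 0 d] \<open>1 \<le> d\<close> by simp_all
  have p0: "p \<noteq> 0"
    using L.X.\<theta>_eq_iff[of 0 1] \<open>1 \<le> d\<close> by (simp add: p_def del: times_divide_eq_right)
  let ?iso = "leonard_pair_iso scaleA scaleA A As
      (scaleA \<xi> A + scaleA \<zeta> 1) (scaleA \<xi>s As + scaleA \<zeta>s 1)"
  let ?c1 = "\<xi> = 1 \<and> \<zeta> = 0 \<and> \<xi>s = 1 \<and> \<zeta>s = 0"
  let ?c2 = "\<phi>1 1 = - \<phi>2 d \<and> \<phi>1 d = - \<phi>2 1 \<and>
      \<xi> = 1 \<and> \<zeta> = 0 \<and> \<xi>s = -1 \<and> \<zeta>s = \<theta>s 0 + \<theta>s d"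
  let ?c3 = "\<phi>1 1 = - \<phi>2 1 \<and> \<phi>1 d = - \<phi>2 d \<and>
      \<xi> = -1 \<and> \<zeta> = \<theta> 0 + \<theta> d \<and> \<xi>s = 1 \<and> \<zeta>s = 0"
  let ?c4 = "\<phi>1 1 = \<phi>1 d \<and> \<phi>2 1 = \<phi>2 d \<and>
      \<xi> = -1 \<and> \<zeta> = \<theta> 0 + \<theta> d \<and> \<xi>s = -1 \<and> \<zeta>s = \<theta>s 0 + \<theta>s d"
  have ends_of_p: "\<theta> 1 + \<theta> (d - 1) = \<theta> 0 + \<theta> d \<longleftrightarrow> p = - q"
    by (auto simp: p_def q_def algebra_simps)
  have ends_of_ps: "\<theta>s 1 + \<theta>s (d - 1) = \<theta>s 0 + \<theta>s d \<longleftrightarrow> ps = - qs"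
    by (auto simp: ps_def qs_def algebra_simps)

  have forward: "?c1 \<or> ?c2 \<or> ?c3 \<or> ?c4" if iso: ?iso
  proof -
    obtain f where f: "algebra_iso scaleA scaleA f" and fA: "f A = scaleA \<xi> A + scaleA \<zeta> 1"
      and fAs: "f As = scaleA \<xi>s As + scaleA \<zeta>s 1"
      using iso unfolding leonard_pair_iso_def by blast
    note first = L.iso_first_cases[OF f fA fAs \<open>\<xi> \<noteq> 0\<close> \<open>\<xi>s \<noteq> 0\<close> x y]
    note second = leonard_frame.iso_first_cases[OF L.dual f fAs fA \<open>\<xi>s \<noteq> 0\<close> \<open>\<xi> \<noteq> 0\<close> a c]
    consider (11) "\<xi> = 1" "\<zeta> = 0" "\<xi>s = 1" "\<zeta>s = 0"
      | (12) "\<xi> = 1" "\<zeta> = 0" "\<xi>s = -1" "\<zeta>s = \<theta>s 0 + \<theta>s d" "x = \<xi>s * x + \<zeta>s" "y = \<xi>s * y + \<zeta>s"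
      | (21) "\<xi> = -1" "\<zeta> = \<theta> 0 + \<theta> d" "\<xi>s = 1" "\<zeta>s = 0" "a = \<xi> * a + \<zeta>" "c = \<xi> * c + \<zeta>"
      | (22) "\<xi> = -1" "\<zeta> = \<theta> 0 + \<theta> d" "\<xi>s = -1" "\<zeta>s = \<theta>s 0 + \<theta>s d"
          "x = \<xi>s * y + \<zeta>s" "\<theta> 1 + \<theta> (d - 1) = \<theta> 0 + \<theta> d"
      using first second by blast
    thus ?thesis
    proof cases
      case 11
      thus ?thesis by simp
    next
      case 12
      have "x - \<theta>s 0 = - (x - \<theta>s d)" "y - \<theta>s d = - (y - \<theta>s 0)"
        using 12(3-6) by (simp_all add: algebra_simps)
      hence "\<phi>1 1 = - \<phi>2 d" "\<phi>1 d = - \<phi>2 1" unfolding F1 F2 F3 F4 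
        by (simp_all only: mult_minus_right mult_minus_left minus_minus)
      thus ?thesis using 12 by simp
    next
      case 21
      have "a - \<theta> 0 = - (a - \<theta> d)" "c - \<theta> d = - (c - \<theta> 0)"
        using 21(1,2,5,6) by (simp_all add: algebra_simps)
      hence "\<phi>1 1 = - \<phi>2 1" "\<phi>1 d = - \<phi>2 d" unfolding G1 G2 G3 G4 
        by (simp_all only: mult_minus_right mult_minus_left minus_minus)
      thus ?thesis using 21 by simp
    next
      case 22
      have "x - \<theta>s 0 = - (y - \<theta>s d)" "x - \<theta>s d = - (y - \<theta>s 0)"
        using 22(3-5) by (simp_all add: algebra_simps)
      moreover have "p = - q" using 22(6) ends_of_p by blast
      ultimately have "\<phi>1 1 = \<phi>1 d" "\<phi>2 1 = \<phi>2 d" unfolding F1 F2 F3 F4 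
        by (simp_all only: mult_minus_right mult_minus_left minus_minus)
      thus ?thesis using 22 by simp
    qed
  qed

  have backward2: ?iso if ?c2
  proof -
    have "ps * (a - \<theta> 0) = - (qs * (c - \<theta> 0))" "qs * (c - \<theta> d) = - (ps * (a - \<theta> d))"
      using that unfolding G1 G2 G3 G4 by blast+
    hence "(ps + qs) * (\<theta> 0 - \<theta> d) = 0" by (simp add: algebra_simps)
    hence "ps = - qs" using ne by (simp add: add_eq_0_iff2)
    hence ends: "\<theta>s 1 + \<theta>s (d - 1) = \<theta>s 0 + \<theta>s d" using ends_of_ps by blast
    have "p * (x - \<theta>s 0) = p * - (x - \<theta>s d)" using that unfolding F1 F2 mult_minus_right by (elim conjE)
    hence "x - \<theta>s 0 = - (x - \<theta>s d)" using p0 by (metis mult_cancel_left)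
    hence "-1 * x + (\<theta>s 0 + \<theta>s d) = x" by (simp add: algebra_simps)
    hence "E 0 * (scaleA (-1) As + scaleA (\<theta>s 0 + \<theta>s d) 1) * E 0 = scaleA x (E 0)"
      using L.diagonal_affine[OF _ x, of "-1" "\<theta>s 0 + \<theta>s d"] by simp
    from leonard_pair_iso_of_frames[OF irr frame L.reflect_second[OF ends] x this]
    show ?thesis using that by simp
  qed

  have backward3: ?iso if ?c3
  proof -
    have *: "p * (x - \<theta>s 0) = - (q * (y - \<theta>s 0))" "q * (y - \<theta>s d) = - (p * (x - \<theta>s d))"
      using that unfolding F1 F2 F3 F4 by blast+
    hence "(p + q) * (\<theta>s 0 - \<theta>s d) = 0" by (simp add: algebra_simps)
    hence pq: "q = - p" using ne by (simp add: add_eq_0_iff)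
    hence ends: "\<theta> 1 + \<theta> (d - 1) = \<theta> 0 + \<theta> d" using ends_of_p by simp
    have "x = y" using *(1) p0 by (simp add: pq)
    hence "E (d - 0) * As * E (d - 0) = scaleA x (E (d - 0))" using y by simp
    from leonard_pair_iso_of_frames[OF irr frame L.reflect_first[OF ends] x this]
    show ?thesis using that by simp
  qed

  have backward4: ?iso if ?c4
  proof -
    have *: "p * (x - \<theta>s 0) = q * (y - \<theta>s d)" "q * (y - \<theta>s 0) = p * (x - \<theta>s d)"
      using that unfolding F1 F2 F3 F4 by blast+
    have "(p + q) * (\<theta>s 0 - \<theta>s d) =
        (p * (x - \<theta>s d) - p * (x - \<theta>s 0)) + (q * (y - \<theta>s d) - q * (y - \<theta>s 0))"
      by (simp add: algebra_simps)
    also have "\<dots> = 0" unfolding * by simp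
    finally have "(p + q) * (\<theta>s 0 - \<theta>s d) = 0" .
    hence pq: "q = - p" using ne by (simp add: add_eq_0_iff)
    hence ends: "\<theta> 1 + \<theta> (d - 1) = \<theta> 0 + \<theta> d" using ends_of_p by simp
    have **: "ps * (a - \<theta> 0) = qs * (c - \<theta> d)" "ps * (a - \<theta> d) = qs * (c - \<theta> 0)"
      using that unfolding G1 G2 G3 G4 by blast+
    have "(ps + qs) * (\<theta> 0 - \<theta> d) =
        (ps * (a - \<theta> d) - ps * (a - \<theta> 0)) + (qs * (c - \<theta> d) - qs * (c - \<theta> 0))"
      by (simp add: algebra_simps)
    also have "\<dots> = 0" unfolding ** by simp
    finally have "(ps + qs) * (\<theta> 0 - \<theta> d) = 0" .
    hence "ps = - qs" using ne by (simp add: add_eq_0_iff2)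
    hence endss: "\<theta>s 1 + \<theta>s (d - 1) = \<theta>s 0 + \<theta>s d" using ends_of_ps by blast
    have "p * (x - \<theta>s 0) = p * - (y - \<theta>s d)" using *(1) unfolding pq by (simp only: mult_minus_left mult_minus_right)
    hence "x - \<theta>s 0 = - (y - \<theta>s d)" using p0 by (metis mult_cancel_left)
    hence "-1 * y + (\<theta>s 0 + \<theta>s d) = x" by (simp add: algebra_simps)
    hence "E (d - 0) * (scaleA (-1) As + scaleA (\<theta>s 0 + \<theta>s d) 1) * E (d - 0) = scaleA x (E (d - 0))"
      using L.diagonal_affine[OF _ y, of "-1" "\<theta>s 0 + \<theta>s d"] by simp
    from leonard_pair_iso_of_frames[OF irr frame
        leonard_frame.reflect_second[OF L.reflect_first[OF ends] endss] x this]
    show ?thesis using that by simp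
  qed

  have backward1: ?iso if ?c1
    using leonard_pair_iso_of_frames[OF irr frame frame x x] that by simp

  (* In characteristic 2 the alternatives are told apart by \<zeta> and \<zeta>s only. *)
  have no: "\<not> ((1::'k) = -1 \<and> \<theta> 0 + \<theta> d = 0)" "\<not> ((1::'k) = -1 \<and> \<theta>s 0 + \<theta>s d = 0)"
    using ne by (metis add_eq_0_iff2 mult_1 mult_minus1)+
  have exclusive: "\<not> (?c1 \<and> ?c2)" "\<not> (?c1 \<and> ?c3)" "\<not> (?c1 \<and> ?c4)"
      "\<not> (?c2 \<and> ?c3)" "\<not> (?c2 \<and> ?c4)" "\<not> (?c3 \<and> ?c4)"
    using no by metis+
  show ?thesis
    unfolding Let_def
    by (rule exactly_one_alternative[OF forward backward1 backward2 backward3 backward4 exclusive])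
qed

end
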